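(* There exists a one-to-one correspondence between $(2n+1)$-dimensional transversely Kähler almost contact metric Lie algebras $(\mathfrak{g},\varphi,\xi,\eta,g)$ of maximal rank with nontrivial center, and $2n$-dimensional Kähler Lie algebras $(\mathfrak{h},J,h,\omega)$ endowed with a symplectic $2$-form $\omega$.
   Context: All Lie algebras are real and finite-dimensional; $d$ is the Chevalley–Eilenberg differential, so $d\eta(X,Y)=-\eta([X,Y])$ for a $1$-form $\eta$. An almost contact metric Lie algebra $(\mathfrak{g},\varphi,\xi,\eta,g)$ is a $(2n+1)$-dimensional Lie algebra $\mathfrak{g}$ with $\varphi\in\mathrm{End}(\mathfrak{g})$, $\xi\in\mathfrak{g}$, $\eta\in\mathfrak{g}^*$ and a positive-definite inner product $g$ such that $\varphi^2=-I+\eta\otimes\xi$, $\eta(\xi)=1$, $g(\varphi X,\varphi Y)=g(X,Y)-\eta(X)\eta(Y)$ for all $X,Y\in\mathfrak{g}$. Its fundamental $2$-form is $\Phi(X,Y)=g(X,\varphi Y)$, and $$N_\varphi(X,Y)=[\varphi X,\varphi Y]+\varphi^2[X,Y]-\varphi[X,\varphi Y]-\varphi[\varphi X,Y]+d\eta(X,Y)\xi .$$ The structure is transversely Kähler if $d\Phi=0$, $N_\varphi(\xi,X)=0$ and $g(N_\varphi(X,Y),Z)=0$ for all $X,Y,Z\in\ker\eta$. It is of maximal rank if $\eta\wedge(d\eta)^n\neq0$, i.e. $\eta$ is a contact form. A Kähler Lie algebra $(\mathfrak{h},J,h)$ is a $2n$-dimensional Lie algebra with $J\in\mathrm{End}(\mathfrak{h})$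 such that $J^2=-I$ and $[JX,JY]-[X,Y]-J[JX,Y]-J[X,JY]=0$ for all $X,Y\in\mathfrak{h}$, and a positive-definite inner product $h$ with $h(JX,JY)=h(X,Y)$ such that the $2$-form $\Omega(X,Y)=h(X,JY)$ is closed (and nondegenerate). A symplectic $2$-form on $\mathfrak{h}$ is a closed nondegenerate $\omega\in\Lambda^2\mathfrak{h}^*$; the notation $(\mathfrak{h},J,h,\omega)$ means a Kähler Lie algebra $(\mathfrak{h},J,h)$ together with a symplectic form $\omega$, which is not required to be related to $\Omega$. *)

theory Defs
  imports "HOL-Analysis.Analysis" "HOL-Combinatorics.Permutations"
begin

text \<open>
  An \<open>m\<close>-dimensional Lie algebra is a bracket on a type of class \<^class>\<open>real_vector\<close> whose
  universe has dimension \<open>m\<close>. The function \<^const>\<open>dim\<close> is not used for this, since it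
  returns \<open>0\<close> also on infinite-dimensional spaces.
\<close>

definition has_dimension :: "'a::real_vector itself \<Rightarrow> nat \<Rightarrow> bool" where
  "has_dimension T m \<longleftrightarrow>
     (\<exists>B :: 'a set. finite B \<and> card B = m \<and> independent B \<and> span B = UNIV)"


section \<open>Lie algebras, forms and the Chevalley--Eilenberg differential\<close>

definition lie_bracket :: "('a::real_vector \<Rightarrow> 'a \<Rightarrow> 'a) \<Rightarrow> bool" where
  "lie_bracket b \<longleftrightarrow> bilinear b \<and> (\<forall>X. b X X = 0) \<and>
     (\<forall>X Y Z. b X (b Y Z) + b Y (b Z X) + b Z (b X Y) = 0)"

definition lie_center :: "('a::real_vector \<Rightarrow> 'a \<Rightarrow> 'a) \<Rightarrow> 'a set" where
  "lie_center b = {Z. \<forall>X. b Z X = 0}"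

definition two_form :: "('a::real_vector \<Rightarrow> 'a \<Rightarrow> real) \<Rightarrow> bool" where
  "two_form w \<longleftrightarrow> bilinear w \<and> (\<forall>X. w X X = 0)"

definition nondegenerate :: "('a::real_vector \<Rightarrow> 'a \<Rightarrow> real) \<Rightarrow> bool" where
  "nondegenerate w \<longleftrightarrow> (\<forall>X. (\<forall>Y. w X Y = 0) \<longrightarrow> X = 0)"

definition inner_product :: "('a::real_vector \<Rightarrow> 'a \<Rightarrow> real) \<Rightarrow> bool" where
  "inner_product g \<longleftrightarrow>
     bilinear g \<and> (\<forall>X Y. g X Y = g Y X) \<and> (\<forall>X. X \<noteq> 0 \<longrightarrow> g X X > 0)"

definition d1 :: "('a::real_vector \<Rightarrow> 'a \<Rightarrow> 'a) \<Rightarrow> ('a \<Rightarrow> real) \<Rightarrow> 'a \<Rightarrow> 'a \<Rightarrow> real" where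
  "d1 b \<alpha> X Y = - \<alpha> (b X Y)"

definition d2 ::
  "('a::real_vector \<Rightarrow> 'a \<Rightarrow> 'a) \<Rightarrow> ('a \<Rightarrow> 'a \<Rightarrow> real) \<Rightarrow> 'a \<Rightarrow> 'a \<Rightarrow> 'a \<Rightarrow> real" where
  "d2 b w X Y Z = - w (b X Y) Z + w (b X Z) Y - w (b Y Z) X"

definition closed_two_form ::
  "('a::real_vector \<Rightarrow> 'a \<Rightarrow> 'a) \<Rightarrow> ('a \<Rightarrow> 'a \<Rightarrow> real) \<Rightarrow> bool" where
  "closed_two_form b w \<longleftrightarrow> two_form w \<and> (\<forall>X Y Z. d2 b w X Y Z = 0)"

definition symplectic_form ::
  "('a::real_vector \<Rightarrow> 'a \<Rightarrow> 'a) \<Rightarrow> ('a \<Rightarrow> 'a \<Rightarrow> real) \<Rightarrow> bool" where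
  "symplectic_form b w \<longleftrightarrow> closed_two_form b w \<and> nondegenerate w"

text \<open>
  A \<open>p\<close>-form is represented by its value on the first \<open>p\<close> entries of a sequence of vectors,
  so that the degree can be a variable; the remaining entries are ignored. With the
  normalisation below, \<open>(\<alpha> \<and> \<beta>)(X, Y) = \<alpha>(X) \<beta>(Y) - \<alpha>(Y) \<beta>(X)\<close> for 1-forms.
\<close>

type_synonym 'a form = "(nat \<Rightarrow> 'a) \<Rightarrow> real"

definition wedge :: "nat \<Rightarrow> nat \<Rightarrow> 'a form \<Rightarrow> 'a form \<Rightarrow> 'a form" where
  "wedge p q \<alpha> \<beta> v =
     (\<Sum>\<sigma> | \<sigma> permutes {..<p + q}.
        of_int (sign \<sigma>) * \<alpha> (\<lambda>i. v (\<sigma> i)) * \<beta> (\<lambda>i. v (\<sigma> (p + i)))) / (fact p * fact q)"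

primrec wedge_power :: "nat \<Rightarrow> 'a form \<Rightarrow> nat \<Rightarrow> 'a form" where
  "wedge_power p \<alpha> 0 = (\<lambda>v. 1)"
| "wedge_power p \<alpha> (Suc k) = wedge p (p * k) \<alpha> (wedge_power p \<alpha> k)"

definition form_of_1 :: "('a \<Rightarrow> real) \<Rightarrow> 'a form" where
  "form_of_1 \<alpha> v = \<alpha> (v 0)"

definition form_of_2 :: "('a \<Rightarrow> 'a \<Rightarrow> real) \<Rightarrow> 'a form" where
  "form_of_2 w v = w (v 0) (v 1)"


section \<open>Almost contact metric Lie algebras\<close>

record 'a metric_lie =
  br :: "'a \<Rightarrow> 'a \<Rightarrow> 'a"
  met :: "'a \<Rightarrow> 'a \<Rightarrow> real"

record 'a acm_lie = "'a metric_lie" +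
  phi :: "'a \<Rightarrow> 'a"
  xi :: "'a"
  eta :: "'a \<Rightarrow> real"

definition almost_contact_metric :: "nat \<Rightarrow> 'a::real_vector acm_lie \<Rightarrow> bool" where
  "almost_contact_metric n G \<longleftrightarrow>
     has_dimension TYPE('a) (2 * n + 1) \<and>
     lie_bracket (br G) \<and> inner_product (met G) \<and> linear (phi G) \<and> linear (eta G) \<and>
     (\<forall>X. phi G (phi G X) = - X + eta G X *\<^sub>R xi G) \<and>
     eta G (xi G) = 1 \<and>
     (\<forall>X Y. met G (phi G X) (phi G Y) = met G X Y - eta G X * eta G Y)"

definition fundamental_form :: "'a::real_vector acm_lie \<Rightarrow> 'a \<Rightarrow> 'a \<Rightarrow> real" where
  "fundamental_form G X Y = met G X (phi G Y)"

definition d_eta :: "'a::real_vector acm_lie \<Rightarrow> 'a \<Rightarrow> 'a \<Rightarrow> real" where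
  "d_eta G = d1 (br G) (eta G)"

definition N_phi :: "'a::real_vector acm_lie \<Rightarrow> 'a \<Rightarrow> 'a \<Rightarrow> 'a" where
  "N_phi G X Y =
     br G (phi G X) (phi G Y) + phi G (phi G (br G X Y))
     - phi G (br G X (phi G Y)) - phi G (br G (phi G X) Y) + d_eta G X Y *\<^sub>R xi G"

definition transversely_Kaehler :: "'a::real_vector acm_lie \<Rightarrow> bool" where
  "transversely_Kaehler G \<longleftrightarrow>
     (\<forall>X Y Z. d2 (br G) (fundamental_form G) X Y Z = 0) \<and>
     (\<forall>X. eta G X = 0 \<longrightarrow> N_phi G (xi G) X = 0) \<and>
     (\<forall>X Y Z. eta G X = 0 \<and> eta G Y = 0 \<and> eta G Z = 0 \<longrightarrow> met G (N_phi G X Y) Z = 0)"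

definition maximal_rank :: "nat \<Rightarrow> 'a::real_vector acm_lie \<Rightarrow> bool" where
  "maximal_rank n G \<longleftrightarrow>
     (\<exists>v. wedge 1 (2 * n) (form_of_1 (eta G)) (wedge_power 2 (form_of_2 (d_eta G)) n) v \<noteq> 0)"

definition tk_max_rank_center :: "nat \<Rightarrow> 'a::real_vector acm_lie set" where
  "tk_max_rank_center n =
     {G. almost_contact_metric n G \<and> transversely_Kaehler G \<and> maximal_rank n G \<and>
         lie_center (br G) \<noteq> {0}}"

definition acm_isomorphic :: "'a::real_vector acm_lie \<Rightarrow> 'a acm_lie \<Rightarrow> bool" where
  "acm_isomorphic G G' \<longleftrightarrow>
     (\<exists>f. linear f \<and> bij f \<and>
       (\<forall>X Y. f (br G X Y) = br G' (f X) (f Y)) \<and>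
       (\<forall>X. f (phi G X) = phi G' (f X)) \<and>
       f (xi G) = xi G' \<and>
       (\<forall>X. eta G' (f X) = eta G X) \<and>
       (\<forall>X Y. met G' (f X) (f Y) = met G X Y))"

definition acm_iso_rel :: "nat \<Rightarrow> ('a::real_vector acm_lie \<times> 'a acm_lie) set" where
  "acm_iso_rel n =
     {(G, G'). G \<in> tk_max_rank_center n \<and> G' \<in> tk_max_rank_center n \<and> acm_isomorphic G G'}"


section \<open>Kaehler Lie algebras with a symplectic form\<close>

record 'a kaehler_lie = "'a metric_lie" +
  cpx :: "'a \<Rightarrow> 'a"
  symp :: "'a \<Rightarrow> 'a \<Rightarrow> real"

definition Kaehler_lie_algebra :: "nat \<Rightarrow> 'a::real_vector kaehler_lie \<Rightarrow> bool" where
  "Kaehler_lie_algebra n H \<longleftrightarrow>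
     has_dimension TYPE('a) (2 * n) \<and>
     lie_bracket (br H) \<and> inner_product (met H) \<and> linear (cpx H) \<and>
     (\<forall>X. cpx H (cpx H X) = - X) \<and>
     (\<forall>X Y. br H (cpx H X) (cpx H Y) - br H X Y
            - cpx H (br H (cpx H X) Y) - cpx H (br H X (cpx H Y)) = 0) \<and>
     (\<forall>X Y. met H (cpx H X) (cpx H Y) = met H X Y) \<and>
     symplectic_form (br H) (\<lambda>X Y. met H X (cpx H Y))"

definition kaehler_symplectic :: "nat \<Rightarrow> 'a::real_vector kaehler_lie set" where
  "kaehler_symplectic n = {H. Kaehler_lie_algebra n H \<and> symplectic_form (br H) (symp H)}"

definition kaehler_isomorphic :: "'a::real_vector kaehler_lie \<Rightarrow> 'a kaehler_lie \<Rightarrow> bool" where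
  "kaehler_isomorphic H H' \<longleftrightarrow>
     (\<exists>f. linear f \<and> bij f \<and>
       (\<forall>X Y. f (br H X Y) = br H' (f X) (f Y)) \<and>
       (\<forall>X. f (cpx H X) = cpx H' (f X)) \<and>
       (\<forall>X Y. met H' (f X) (f Y) = met H X Y) \<and>
       (\<forall>X Y. symp H' (f X) (f Y) = symp H X Y))"

definition kaehler_iso_rel :: "nat \<Rightarrow> ('a::real_vector kaehler_lie \<times> 'a kaehler_lie) set" where
  "kaehler_iso_rel n =
     {(H, H'). H \<in> kaehler_symplectic n \<and> H' \<in> kaehler_symplectic n \<and> kaehler_isomorphic H H'}"


section \<open>The correspondence\<close>

text \<open>
  \<open>H\<close> is the quotient of \<open>G\<close> by its center with the projected structure, and \<open>d\<eta>\<close>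
  is the pullback of \<open>\<omega>\<close>. Equivalently, \<open>G\<close> is the central extension of \<open>H\<close> by \<open>\<omega>\<close>,
  with bracket \<open>[X, Y] = [X, Y]\<^sub>H - \<omega>(X, Y) \<xi>\<close> on \<open>ker \<eta>\<close>. The two algebras live on
  different types, so the quotient map is part of the data.
\<close>

definition central_quotient ::
  "'a::real_vector acm_lie \<Rightarrow> 'b::real_vector kaehler_lie \<Rightarrow> bool" where
  "central_quotient G H \<longleftrightarrow>
     (\<exists>\<pi>. linear \<pi> \<and> surj \<pi> \<and> {X. \<pi> X = 0} = lie_center (br G) \<and>
       (\<forall>X Y. \<pi> (br G X Y) = br H (\<pi> X) (\<pi> Y)) \<and>
       (\<forall>X. \<pi> (phi G X) = cpx H (\<pi> X)) \<and>
       (\<forall>X Y. eta G X = 0 \<and> eta G Y = 0 \<longrightarrow> met H (\<pi> X) (\<pi> Y) = met G X Y) \<and>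
       (\<forall>X Y. symp H (\<pi> X) (\<pi> Y) = d_eta G X Y))"

definition quotient_class :: "'a::real_vector acm_lie set \<Rightarrow> 'b::real_vector kaehler_lie set" where
  "quotient_class C = {H. \<exists>G\<in>C. central_quotient G H}"

end

theory Submission
  imports Defs
begin

text \<open>
  Maximal rank says that \<open>d\<eta>\<close> is nondegenerate on \<open>ker \<eta>\<close>. The condition
  \<open>N\<^sub>\<phi>(\<xi>, X) = 0\<close> makes \<open>\<xi>\<close> the Reeb vector, so a nontrivial center must be the line
  \<open>\<real>\<xi>\<close>: a central \<open>Z\<close> is annihilated by \<open>d\<eta>\<close>, hence so is \<open>Z - \<eta>(Z)\<xi> \<in> ker \<eta>\<close>.
  Choosing a linear section \<open>s\<close> of the quotient map \<open>p\<close> with image \<open>ker \<eta>\<close> writes \<open>G\<close> as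
  the central extension of \<open>H\<close> by \<open>\<omega> = d\<eta>\<close>, and then the axioms translate one by one:
  the \<open>\<xi>\<close>-component of the Jacobi identity is \<open>d\<omega> = 0\<close>, the \<open>ker \<eta>\<close>-component of
  \<open>N\<^sub>\<phi>\<close> is the Nijenhuis tensor of \<open>J\<close>, and \<open>\<Phi>\<close> is the pullback of \<open>\<Omega>\<close>. Conversely,
  a Darboux basis of \<open>\<omega>\<close> shows that \<open>\<eta> \<and> (d\<eta>)\<^sup>n\<close> does not vanish.
\<close>

section \<open>Multilinear and alternating forms\<close>

text \<open>A form takes a whole sequence of vectors, so the dependence on the first
  \<open>p\<close> entries alone has to be part of the property.\<close>

definition multilinear_form :: "nat \<Rightarrow> 'a::real_vector form \<Rightarrow> bool" where
  "multilinear_form p \<alpha> \<longleftrightarrow>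
     (\<forall>v w. (\<forall>i<p. v i = w i) \<longrightarrow> \<alpha> v = \<alpha> w) \<and> (\<forall>v. \<forall>i<p. linear (\<lambda>x. \<alpha> (v(i := x))))"

definition skew_form :: "nat \<Rightarrow> 'a form \<Rightarrow> bool" where
  "skew_form p \<alpha> \<longleftrightarrow>
     (\<forall>v \<tau>. \<tau> permutes {..<p} \<longrightarrow> \<alpha> (\<lambda>i. v (\<tau> i)) = of_int (sign \<tau>) * \<alpha> v)"

text \<open>Every slot is tested, not only the first: the property then passes to wedge products
  summand by summand, without an appeal to skewness.\<close>

definition annihilates :: "'a \<Rightarrow> nat \<Rightarrow> 'a form \<Rightarrow> bool" where
  "annihilates x p \<alpha> \<longleftrightarrow> (\<forall>v. \<forall>i<p. v i = x \<longrightarrow> \<alpha> v = 0)"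

lemma multilinear_wedge:
  assumes "multilinear_form p \<alpha>" "multilinear_form q \<beta>"
  shows "multilinear_form (p + q) (wedge p q \<alpha> \<beta>)"
proof -
  have ca: "\<alpha> v = \<alpha> w" if "\<And>i. i < p \<Longrightarrow> v i = w i" for v w
    using assms(1) that unfolding multilinear_form_def by blast
  have cb: "\<beta> v = \<beta> w" if "\<And>i. i < q \<Longrightarrow> v i = w i" for v w
    using assms(2) that unfolding multilinear_form_def by blast
  have la: "linear (\<lambda>x. \<alpha> (v(i := x)))" if "i < p" for v i
    using assms(1) that unfolding multilinear_form_def by blast
  have lb: "linear (\<lambda>x. \<beta> (v(i := x)))" if "i < q" for v i
    using assms(2) that unfolding multilinear_form_def by blast
  have "wedge p q \<alpha> \<beta> v = wedge p q \<alpha> \<beta> w" if vw: "\<forall>i<p + q. v i = w i" for v w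
  proof -
    have "\<alpha> (\<lambda>i. v (\<sigma> i)) = \<alpha> (\<lambda>i. w (\<sigma> i)) \<and> \<beta> (\<lambda>i. v (\<sigma> (p + i))) = \<beta> (\<lambda>i. w (\<sigma> (p + i)))"
      if s: "\<sigma> permutes {..<p + q}" for \<sigma>
    proof -
      have "\<sigma> i < p + q" if "i < p + q" for i
        using permutes_in_image[OF s, of i] that by simp
      then show ?thesis
        using vw by (intro conjI ca cb) auto
    qed
    then show ?thesis
      unfolding wedge_def by (intro arg_cong2[where f="(/)"] sum.cong refl) auto
  qed
  moreover have "linear (\<lambda>x. wedge p q \<alpha> \<beta> (v(j := x)))" if j: "j < p + q" for v j
  proof -
    have lin: "linear (\<lambda>x. of_int (sign \<sigma>) * \<alpha> (\<lambda>i. (v(j := x)) (\<sigma> i)) *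
        \<beta> (\<lambda>i. (v(j := x)) (\<sigma> (p + i))))"
      if s: "\<sigma> permutes {..<p + q}" for \<sigma>
    proof -
      \<comment> \<open>After the permutation the entry \<open>v j\<close> sits in slot
        \<open>k\<close>. This is a slot of \<open>\<alpha>\<close> if \<open>k < p\<close>, and
        slot \<open>k - p\<close> of \<open>\<beta>\<close> otherwise; the other factor does not
        depend on \<open>x\<close>.\<close>
      define k where "k = inv \<sigma> j"
      have sk: "\<sigma> i = j \<longleftrightarrow> i = k" for i
        using permutes_inverses[OF s] unfolding k_def by metis
      have k: "k < p + q"
        using j permutes_in_image[OF permutes_inv[OF s], of j] unfolding k_def by simp
      have upd: "(v(j := x)) (\<sigma> i) = ((\<lambda>i. v (\<sigma> i))(k := x)) i" for x i
        using sk by auto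
      show ?thesis
      proof (cases "k < p")
        case True
        have "\<beta> (\<lambda>i. (v(j := x)) (\<sigma> (p + i))) = \<beta> (\<lambda>i. v (\<sigma> (p + i)))" for x
          by (rule cb) (use True in \<open>simp add: upd del: fun_upd_apply; simp\<close>)
        moreover have "(\<lambda>i. (v(j := x)) (\<sigma> i)) = (\<lambda>i. v (\<sigma> i))(k := x)" for x
          using upd by (intro ext)
        ultimately show ?thesis
          using la[OF True, of "\<lambda>i. v (\<sigma> i)"] by (auto simp: linear_iff algebra_simps)
      next
        case False
        then have kq: "k - p < q"
          using k by simp
        have "\<alpha> (\<lambda>i. (v(j := x)) (\<sigma> i)) = \<alpha> (\<lambda>i. v (\<sigma> i))" for x
          by (rule ca) (use False in \<open>simp add: upd del: fun_upd_apply; simp\<close>)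
        moreover have "(\<lambda>i. (v(j := x)) (\<sigma> (p + i))) = (\<lambda>i. v (\<sigma> (p + i)))(k - p := x)" for x
          using False by (auto simp: upd fun_eq_iff simp del: fun_upd_apply) auto
        ultimately show ?thesis
          using lb[OF kq, of "\<lambda>i. v (\<sigma> (p + i))"] by (auto simp: linear_iff algebra_simps)
      qed
    qed
    have "linear (\<lambda>x. \<Sum>\<sigma> | \<sigma> permutes {..<p + q}. of_int (sign \<sigma>) * \<alpha> (\<lambda>i. (v(j := x)) (\<sigma> i)) *
        \<beta> (\<lambda>i. (v(j := x)) (\<sigma> (p + i))))"
      by (rule linear_compose_sum) (use lin in blast)
    from linear_compose_scale_right[OF this, of "1 / (fact p * fact q)"] show ?thesis
      unfolding wedge_def by simp
  qed
  ultimately show ?thesis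
    unfolding multilinear_form_def by blast
qed

text \<open>The wedge sums over all permutations, so \<open>\<tau>\<close> is absorbed by the
  substitution of \<open>\<tau> \<circ> \<sigma>\<close> for \<open>\<sigma>\<close>, at the cost of
  its sign.\<close>

lemma skew_wedge: "skew_form (p + q) (wedge p q \<alpha> \<beta>)"
  unfolding skew_form_def
proof (intro allI impI)
  fix v :: "nat \<Rightarrow> 'a" and \<tau>
  assume t: "\<tau> permutes {..<p + q}"
  let ?S = "{\<sigma>. \<sigma> permutes {..<p + q}}"
  have ti: "inv \<tau> permutes {..<p + q}"
    using t by (rule permutes_inv)
  let ?f = "\<lambda>u \<sigma>. of_int (sign \<sigma>) * \<alpha> (\<lambda>i. u (\<sigma> i)) * \<beta> (\<lambda>i. u (\<sigma> (p + i)))"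
  have "(\<Sum>\<sigma>\<in>?S. ?f (\<lambda>i. v (\<tau> i)) \<sigma>) = (\<Sum>\<sigma>\<in>?S. of_int (sign \<tau>) * ?f v \<sigma>)"
  proof (rule sum.reindex_bij_witness[where i="\<lambda>\<sigma>. inv \<tau> \<circ> \<sigma>" and j="\<lambda>\<sigma>. \<tau> \<circ> \<sigma>"])
    fix \<sigma> assume "\<sigma> \<in> ?S"
    then have s: "\<sigma> permutes {..<p + q}" by simp
    show "\<tau> \<circ> \<sigma> \<in> ?S" "inv \<tau> \<circ> \<sigma> \<in> ?S"
      using s t ti by (auto intro: permutes_compose)
    show "inv \<tau> \<circ> (\<tau> \<circ> \<sigma>) = \<sigma>" "\<tau> \<circ> (inv \<tau> \<circ> \<sigma>) = \<sigma>"
      using permutes_inverses[OF t] by (simp_all add: fun_eq_iff)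
    have "sign (\<tau> \<circ> \<sigma>) = sign \<tau> * sign \<sigma>"
      using s t by (intro sign_compose) (auto intro: permutes_imp_permutation[rotated])
    then show "of_int (sign \<tau>) * ?f v (\<tau> \<circ> \<sigma>) = ?f (\<lambda>i. v (\<tau> i)) \<sigma>"
      by (simp add: mult.assoc[symmetric] flip: of_int_mult)
  qed
  then show "wedge p q \<alpha> \<beta> (\<lambda>i. v (\<tau> i)) = of_int (sign \<tau>) * wedge p q \<alpha> \<beta> v"
    unfolding wedge_def by (simp add: sum_distrib_left)
qed

text \<open>In every summand the entry \<open>x\<close> ends up in a slot of one of the two
  factors.\<close>

lemma annihilates_wedge:
  assumes "annihilates x p \<alpha>" "annihilates x q \<beta>"
  shows "annihilates x (p + q) (wedge p q \<alpha> \<beta>)"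
  unfolding annihilates_def
proof (intro allI impI)
  fix v :: "nat \<Rightarrow> 'a" and j
  assume j: "j < p + q" and v: "v j = x"
  have "\<alpha> (\<lambda>i. v (\<sigma> i)) = 0 \<or> \<beta> (\<lambda>i. v (\<sigma> (p + i))) = 0" if s: "\<sigma> permutes {..<p + q}" for \<sigma>
  proof -
    define k where "k = inv \<sigma> j"
    have sk: "\<sigma> k = j"
      using permutes_inverses[OF s] unfolding k_def by metis
    have k: "k < p + q"
      using j permutes_in_image[OF permutes_inv[OF s], of j] unfolding k_def by simp
    show ?thesis
    proof (cases "k < p")
      case True
      then show ?thesis
        using assms(1) sk v unfolding annihilates_def by metis
    next
      case False
      then have "k - p < q" "p + (k - p) = k"
        using k by auto
      then show ?thesis
        using assms(2) sk v unfolding annihilates_def by metis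
    qed
  qed
  then show "wedge p q \<alpha> \<beta> v = 0"
    unfolding wedge_def by (auto intro!: sum.neutral)
qed

lemma multilinear_wedge_power:
  "multilinear_form p \<alpha> \<Longrightarrow> multilinear_form (p * k) (wedge_power p \<alpha> k)"
proof (induction k)
  case 0
  then show ?case by (simp add: multilinear_form_def)
next
  case (Suc k)
  then show ?case using multilinear_wedge[of p \<alpha> "p * k"] by simp
qed

lemma skew_wedge_power: "skew_form (p * k) (wedge_power p \<alpha> k)"
proof (cases k)
  case 0
  then show ?thesis by (simp add: skew_form_def)
next
  case (Suc l)
  then show ?thesis using skew_wedge[of p "p * l"] by simp
qed

lemma annihilates_wedge_power:
  "annihilates x p \<alpha> \<Longrightarrow> annihilates x (p * k) (wedge_power p \<alpha> k)"
proof (induction k)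
  case 0
  then show ?case by (simp add: annihilates_def)
next
  case (Suc k)
  then show ?case using annihilates_wedge[of x p \<alpha> "p * k"] by simp
qed

lemma multilinear_form_of_1: "linear e \<Longrightarrow> multilinear_form 1 (form_of_1 e)"
  by (simp add: multilinear_form_def form_of_1_def linear_iff)

lemma multilinear_form_of_2: "bilinear w \<Longrightarrow> multilinear_form 2 (form_of_2 w)"
  unfolding multilinear_form_def form_of_2_def
  by (auto simp: less_2_cases_iff linear_iff bilinear_ladd bilinear_radd bilinear_lmul bilinear_rmul)

lemma skew_form_repeated:
  assumes "skew_form m \<alpha>" "i < m" "j < m" "i \<noteq> j" "v i = v j"
  shows "\<alpha> v = 0"
proof -
  have "(\<lambda>l. v (Transposition.transpose i j l)) = v"
    using assms(5) by (auto simp: Transposition.transpose_def fun_eq_iff)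
  moreover have "Transposition.transpose i j permutes {..<m}"
    using assms by (intro permutes_swap_id) auto
  ultimately have "\<alpha> v = - \<alpha> v"
    using assms(1,4) unfolding skew_form_def by (metis sign_swap_id of_int_minus of_int_1 mult_minus1)
  then show ?thesis by simp
qed

section \<open>Counting vectors in a space of given dimension\<close>

lemma has_dimension_independent_card:
  fixes S :: "'a::real_vector set"
  assumes "has_dimension TYPE('a) m" "independent S"
  shows "finite S" "card S \<le> m"
proof -
  obtain B :: "'a set" where "finite B" "card B = m" "span B = UNIV"
    using assms(1) unfolding has_dimension_def by blast
  then show "finite S" "card S \<le> m"
    using independent_span_bound[of B S] assms(2) by auto
qed

lemma has_dimension_span:
  fixes S :: "'a::real_vector set"
  assumes "has_dimension TYPE('a) m" "independent S" "card S = m"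
  shows "span S = UNIV"
proof (rule ccontr)
  assume "span S \<noteq> UNIV"
  then obtain x where x: "x \<notin> span S" by blast
  then have "independent (insert x S)"
    using assms(2) by (rule independent_insertI)
  moreover have "card (insert x S) = Suc m"
    using x assms has_dimension_independent_card(1)[OF assms(1,2)]
    by (subst card_insert_disjoint) (auto intro: span_base)
  ultimately show False
    using has_dimension_independent_card(2)[OF assms(1)] by fastforce
qed

lemma has_dimension_span_ge:
  fixes S :: "'a::real_vector set"
  assumes "has_dimension TYPE('a) m" "span S = UNIV" "finite S"
  shows "m \<le> card S"
proof -
  obtain B :: "'a set" where "finite B" "card B = m" "independent B"
    using assms(1) unfolding has_dimension_def by blast
  then show ?thesis
    using independent_span_bound[of S B] assms by auto
qed

text \<open>
  If \<open>T v\<close> is not zero then \<open>v\<close> is a basis, and replacing \<open>v i\<close> by \<open>x\<close> multiplies the value by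
  the \<open>i\<close>-th coordinate of \<open>x\<close>.
\<close>

lemma top_form_annihilated:
  fixes T :: "'a::real_vector form"
  assumes dim: "has_dimension TYPE('a) m"
    and ml: "multilinear_form m T" and sk: "skew_form m T"
    and v: "T v \<noteq> 0" and x: "annihilates x m T"
  shows "x = 0"
proof -
  have lin: "linear (\<lambda>y. T (v(i := y)))" if "i < m" for i
    using ml that unfolding multilinear_form_def by blast
  have rep: "T (v(i := v j)) = 0" if "i < m" "j < m" "i \<noteq> j" for i j
    by (rule skew_form_repeated[OF sk that]) (use that in simp)
  have inj: "inj_on v {..<m}"
    using skew_form_repeated[OF sk] v by (auto simp: inj_on_def)
  \<comment> \<open>As a function of slot \<open>i\<close> alone, \<open>T\<close> is linear and
    vanishes on the other \<open>v j\<close> by repetition. If \<open>v i\<close> were in their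
    span, \<open>T v\<close> would vanish too.\<close>
  have ind: "independent (v ` {..<m})"
    unfolding dependent_def
  proof (clarsimp)
    fix i assume i: "i < m" and "v i \<in> span (v ` {..<m} - {v i})"
    moreover have "T (v(i := y)) = 0" if "y \<in> v ` {..<m} - {v i}" for y
      using that rep[OF i] by auto
    ultimately have "T (v(i := v i)) = 0"
      using linear_eq_0_on_span[OF lin[OF i]] by blast
    then show False using v by simp
  qed
  have "span (v ` {..<m}) = UNIV"
    by (rule has_dimension_span[OF dim ind]) (simp add: card_image inj)
  then obtain c where "x = (\<Sum>y\<in>v ` {..<m}. c y *\<^sub>R y)"
    using span_finite[of "v ` {..<m}"] by auto
  then have xs: "x = (\<Sum>j<m. c (v j) *\<^sub>R v j)"
    using inj by (simp add: sum.reindex)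
  have "c (v i) = 0" if i: "i < m" for i
  proof -
    have "0 = T (v(i := x))"
      using x i unfolding annihilates_def by simp
    also have "\<dots> = (\<Sum>j<m. c (v j) * T (v(i := v j)))"
      unfolding xs by (simp add: linear_sum[OF lin[OF i]] linear_cmul[OF lin[OF i], simplified])
    also have "\<dots> = (\<Sum>j<m. if j = i then c (v i) * T v else 0)"
      by (rule sum.cong) (use i rep[OF i] in auto)
    finally show ?thesis
      using v i by simp
  qed
  then show ?thesis
    unfolding xs by simp
qed

lemma two_form_swap:
  assumes "two_form w"
  shows "w x y = - w y x"
proof -
  have bl: "bilinear w" and alt: "\<And>z. w z z = 0"
    using assms unfolding two_form_def by auto
  have "w (x + y) (x + y) = w x y + w y x"
    by (simp add: bilinear_ladd[OF bl] bilinear_radd[OF bl] alt[of x] alt[of y])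
  then show ?thesis
    using alt[of "x + y"] by linarith
qed

text \<open>Such an \<open>x\<close> is annihilated by both factors of the wedge, hence by a nonzero
  top form. This is the form in which maximal rank is used.\<close>

lemma contact_nondegenerate:
  fixes w :: "'a::real_vector \<Rightarrow> 'a \<Rightarrow> real"
  assumes dim: "has_dimension TYPE('a) (2 * n + 1)"
    and e: "linear e" and w: "two_form w"
    and v: "wedge 1 (2 * n) (form_of_1 e) (wedge_power 2 (form_of_2 w) n) v \<noteq> 0"
    and x: "e x = 0" "\<And>y. w x y = 0"
  shows "x = 0"
proof (rule top_form_annihilated[where T="wedge 1 (2 * n) (form_of_1 e) (wedge_power 2 (form_of_2 w) n)"])
  show "has_dimension TYPE('a) (2 * n + 1)" "wedge 1 (2 * n) (form_of_1 e) (wedge_power 2 (form_of_2 w) n) v \<noteq> 0"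
    by (fact dim, fact v)
  have bl: "bilinear w"
    using w unfolding two_form_def by simp
  have "w y x = 0" for y
    using two_form_swap[OF w, of y x] x(2) by simp
  then have "annihilates x 2 (form_of_2 w)"
    using x by (auto simp: annihilates_def form_of_2_def less_2_cases_iff)
  moreover have "annihilates x 1 (form_of_1 e)"
    using x by (simp add: annihilates_def form_of_1_def)
  \<comment> \<open>The wedge has degree \<open>1 + 2 * n\<close>, while the dimension is written
    \<open>2 * n + 1\<close>; hence \<open>add.commute\<close> here and below.\<close>
  ultimately show "annihilates x (2 * n + 1) (wedge 1 (2 * n) (form_of_1 e) (wedge_power 2 (form_of_2 w) n))"
    by (metis annihilates_wedge annihilates_wedge_power add.commute)
  show "multilinear_form (2 * n + 1) (wedge 1 (2 * n) (form_of_1 e) (wedge_power 2 (form_of_2 w) n))"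
    by (metis multilinear_wedge multilinear_wedge_power multilinear_form_of_1[OF e]
        multilinear_form_of_2[OF bl] add.commute)
  show "skew_form (2 * n + 1) (wedge 1 (2 * n) (form_of_1 e) (wedge_power 2 (form_of_2 w) n))"
    by (metis skew_wedge add.commute)
qed


section \<open>Symplectic bases\<close>

text \<open>Partners are the adjacent indices \<open>2 * j\<close> and \<open>2 * j + 1\<close>. An
  initial segment of even length, or a tail that starts at an even index, is then again of this
  shape, as both inductions below require.\<close>

definition darboux :: "nat \<Rightarrow> ('a \<Rightarrow> 'a \<Rightarrow> real) \<Rightarrow> (nat \<Rightarrow> 'a) \<Rightarrow> bool" where
  "darboux m w v \<longleftrightarrow> (\<forall>i<m. \<forall>j<m. w (v i) (v j) =
     (if even i \<and> j = Suc i then 1 else if odd i \<and> i = Suc j then - 1 else 0))"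

lemma darbouxD:
  "darboux m w v \<Longrightarrow> i < m \<Longrightarrow> j < m \<Longrightarrow> w (v i) (v j) =
     (if even i \<and> j = Suc i then 1 else if odd i \<and> i = Suc j then - 1 else 0)"
  unfolding darboux_def by blast

text \<open>A permutation of the block of \<open>m\<close> indices starting at \<open>d\<close>
  permutes the slots of \<open>\<beta>\<close>. Induction over transpositions avoids conjugating
  \<open>\<sigma>\<close> by the shift.\<close>

lemma skew_form_shift:
  assumes "skew_form m \<beta>" "\<sigma> permutes {d..<d + m}"
  shows "\<beta> (\<lambda>i. v (\<sigma> (d + i))) = of_int (sign \<sigma>) * \<beta> (\<lambda>i. v (d + i))"
  using finite_atLeastLessThan assms(2)
proof (induction rule: permutes_rev_induct)
  case id
  then show ?case by simp
next
  case (swap a b p)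
  let ?t = "Transposition.transpose (a - d) (b - d)"
  have "?t permutes {..<m}"
    using swap by (intro permutes_swap_id) auto
  then have "\<beta> (\<lambda>i. v (p (d + ?t i))) = of_int (sign ?t) * \<beta> (\<lambda>i. v (p (d + i)))"
    using assms(1)[unfolded skew_form_def, rule_format, of ?t "\<lambda>i. v (p (d + i))"] by simp
  moreover have "Transposition.transpose a b (d + i) = d + ?t i" for i
    using swap by (auto simp: Transposition.transpose_def)
  moreover have "sign ?t = - 1"
    using swap by (auto simp: sign_swap_id)
  moreover have "sign (p \<circ> Transposition.transpose a b) = - sign p"
    using swap
    by (subst sign_compose) (auto simp: sign_swap_id permutation_swap_id intro: permutes_imp_permutation[rotated])
  ultimately show ?case
    using swap.IH by (simp add: o_def)
qed

text \<open>
  No summand of the wedge product is negative: a summand that is not zero picks a pair of the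
  basis for the two slots of \<open>w\<close>, and moving this pair to the front is an even permutation.
\<close>

lemma wedge_power_darboux_pos:
  assumes "darboux (2 * k) w v"
  shows "wedge_power 2 (form_of_2 w) k v > 0"
  using assms
proof (induction k arbitrary: v)
  case 0
  then show ?case by simp
next
  case (Suc k)
  let ?W = "wedge_power 2 (form_of_2 w) k"
  let ?m = "2 + 2 * k"
  \<comment> \<open>The summand of \<open>\<sigma>\<close> without the factorials. The sequence
    \<open>u\<close> stays variable because the reduction below changes \<open>u\<close> and
    \<open>\<sigma>\<close> together.\<close>
  define t where "t u \<sigma> = of_int (sign \<sigma>) * w (u (\<sigma> 0)) (u (\<sigma> 1)) * ?W (\<lambda>i. u (\<sigma> (2 + i)))"
    for u :: "nat \<Rightarrow> 'a" and \<sigma>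
  have perm: "permutation \<sigma>" if "\<sigma> permutes {..<?m}" for \<sigma>
    using that by (rule permutes_imp_permutation[rotated]) simp
  \<comment> \<open>With the first pair left in place, \<open>sign \<sigma>\<close> occurs twice, in
    the summand and in reordering the tail, and cancels. The tail is covered by the induction
    hypothesis.\<close>
  have fix2: "t u \<sigma> > 0"
    if u: "darboux ?m w u" and s: "\<sigma> permutes {..<?m}" and s0: "\<sigma> 0 = 0" "\<sigma> 1 = 1" for u \<sigma>
  proof -
    have "\<sigma> permutes {2..<?m}"
    proof (rule permutes_superset[OF s])
      fix x assume "x \<in> {..<?m} - {2..<?m}"
      then have "x = 0 \<or> x = 1" by auto
      then show "\<sigma> x = x" using s0 by auto
    qed
    then have "?W (\<lambda>i. u (\<sigma> (2 + i))) = of_int (sign \<sigma>) * ?W (\<lambda>i. u (2 + i))"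
      by (rule skew_form_shift[OF skew_wedge_power])
    moreover have "w (u 0) (u 1) = 1"
      using darbouxD[OF u, of 0 1] by simp
    moreover have "darboux (2 * k) w (\<lambda>i. u (2 + i))"
      using u unfolding darboux_def by auto
    then have "?W (\<lambda>i. u (2 + i)) > 0"
      by (rule Suc.IH)
    moreover have "of_int (sign \<sigma>) * (of_int (sign \<sigma>) * x) = x" for x :: real
      by (simp flip: of_int_mult add: mult.assoc[symmetric])
    ultimately show ?thesis
      unfolding t_def s0 by (simp only: mult_1_right)
  qed
  have ordered: "t u \<sigma> \<ge> 0"
    if u: "darboux ?m w u" and s: "\<sigma> permutes {..<?m}" and ev: "even (\<sigma> 0)" and s1: "\<sigma> 1 = Suc (\<sigma> 0)" for u \<sigma>
  proof -
    define a where "a = \<sigma> 0"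
    \<comment> \<open>\<open>\<rho>\<close> exchanges the first pair with the pair chosen by
      \<open>\<sigma>\<close>. Since \<open>a\<close> is even, it is the identity for
      \<open>a = 0\<close> and a product of two disjoint transpositions otherwise, so it is even and
      an involution.\<close>
    define \<rho> where "\<rho> = Transposition.transpose 0 a \<circ> Transposition.transpose 1 (Suc a)"
    have am: "Suc a < ?m"
      using permutes_in_image[OF s, of 1] s1 unfolding a_def by simp
    have \<rho>: "\<rho> i = (if i = 0 then a else if i = 1 then Suc a else if i = a then 0
        else if i = Suc a then 1 else i)" for i
      using ev unfolding \<rho>_def a_def[symmetric] Transposition.transpose_def by auto
    have \<rho>\<rho>: "\<rho> (\<rho> i) = i" for i
      using ev unfolding \<rho> a_def[symmetric] by auto
    have \<rho>p: "\<rho> permutes {..<?m}"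
      unfolding \<rho>_def using am by (intro permutes_compose permutes_swap_id) auto
    have "sign \<rho> = 1"
      unfolding \<rho>_def using ev
      by (subst sign_compose) (auto simp: sign_swap_id permutation_swap_id a_def)
    then have sgn: "sign (\<rho> \<circ> \<sigma>) = sign \<sigma>"
      using sign_compose[OF perm[OF \<rho>p] perm[OF s]] by simp
    have \<rho>_pair: "even (\<rho> i) \<and> \<rho> (Suc i) = Suc (\<rho> i)" if "even i" for i
    proof -
      consider "i = 0" | "i = a" "i \<noteq> 0" | "i \<noteq> 0" "i \<noteq> a" by blast
      then show ?thesis
      proof cases
        case 3
        have "i \<noteq> 1" "i \<noteq> Suc a" "Suc i \<noteq> a"
          using that ev unfolding a_def[symmetric] by auto
        with 3 that show ?thesis by (simp add: \<rho>)
      qed (use ev in \<open>auto simp: \<rho> a_def[symmetric]\<close>)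
    qed
    \<comment> \<open>\<open>\<rho>\<close> respects the pairing, so relabelling by
      \<open>\<rho>\<close> gives a Darboux family again.\<close>
    have \<rho>_iff: "even (\<rho> i) \<and> \<rho> j = Suc (\<rho> i) \<longleftrightarrow> even i \<and> j = Suc i" for i j
      using \<rho>_pair[of i] \<rho>_pair[of "\<rho> i"] \<rho>\<rho> by metis
    have "darboux ?m w (\<lambda>i. u (\<rho> i))"
      unfolding darboux_def
    proof (intro allI impI)
      fix i j assume ij: "i < ?m" "j < ?m"
      have "\<rho> i < ?m" "\<rho> j < ?m"
        using permutes_in_image[OF \<rho>p] ij by auto
      from darbouxD[OF u this]
      show "w (u (\<rho> i)) (u (\<rho> j)) =
        (if even i \<and> j = Suc i then 1 else if odd i \<and> i = Suc j then - 1 else 0)"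
        using \<rho>_iff[of i j] \<rho>_iff[of j i] by (metis even_Suc)
    qed
    moreover have "\<rho> \<circ> \<sigma> permutes {..<?m}"
      using s \<rho>p by (rule permutes_compose)
    moreover have "(\<rho> \<circ> \<sigma>) 0 = 0" "(\<rho> \<circ> \<sigma>) 1 = 1"
      using s1 ev by (auto simp: \<rho> a_def)
    \<comment> \<open>As \<open>\<rho>\<close> is an even involution, this is the same number as
      \<open>t u \<sigma>\<close>.\<close>
    ultimately have "t (\<lambda>i. u (\<rho> i)) (\<rho> \<circ> \<sigma>) > 0"
      by (rule fix2)
    then show ?thesis
      unfolding t_def sgn by (simp add: \<rho>\<rho>)
  qed
  have nonneg: "t u \<sigma> \<ge> 0" if u: "darboux ?m w u" and s: "\<sigma> permutes {..<?m}" for u \<sigma>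
  proof -
    have lt: "\<sigma> 0 < ?m" "\<sigma> 1 < ?m"
      using permutes_in_image[OF s] by auto
    note d = darbouxD[OF u lt] darbouxD[OF u lt(2) lt(1)]
    consider "even (\<sigma> 0)" "\<sigma> 1 = Suc (\<sigma> 0)" | "odd (\<sigma> 0)" "\<sigma> 0 = Suc (\<sigma> 1)" | "w (u (\<sigma> 0)) (u (\<sigma> 1)) = 0"
      using d(1) by metis
    then show ?thesis
    proof cases
      case 1
      then show ?thesis by (rule ordered[OF u s])
    next
      case 2
      \<comment> \<open>A pair chosen in reverse order: exchanging the two slots of \<open>w\<close>
        changes the sign of the permutation and that of \<open>w\<close>, and leaves the tail
        alone.\<close>
      let ?\<sigma> = "\<sigma> \<circ> Transposition.transpose 0 1"
      have tr: "Transposition.transpose 0 1 permutes {..<?m}"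
        by (intro permutes_swap_id) auto
      have "t u ?\<sigma> \<ge> 0"
        by (rule ordered[OF u permutes_compose[OF tr s]]) (use 2 in auto)
      moreover have "sign ?\<sigma> = - sign \<sigma>"
        using sign_compose[OF perm[OF s] perm[OF tr]] by (simp add: sign_swap_id)
      moreover have "w (u (\<sigma> 1)) (u (\<sigma> 0)) = - w (u (\<sigma> 0)) (u (\<sigma> 1))"
        using d 2 by simp
      moreover have "Transposition.transpose 0 1 (2 + i) = 2 + i" for i :: nat
        by (simp add: Transposition.transpose_def)
      ultimately show ?thesis
        unfolding t_def by simp
    next
      case 3
      then show ?thesis by (simp add: t_def)
    qed
  qed
  have v: "darboux ?m w v"
    using Suc.prems by simp
  \<comment> \<open>The identity contributes a positive summand, so nothing has to be
    counted.\<close>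
  have "(\<Sum>\<sigma> | \<sigma> permutes {..<?m}. t v \<sigma>) > 0"
    by (rule sum_pos2[where i=id])
      (use nonneg[OF v] fix2[OF v] in \<open>auto simp: finite_permutations permutes_id\<close>)
  moreover have "wedge_power 2 (form_of_2 w) (Suc k) v =
      (\<Sum>\<sigma> | \<sigma> permutes {..<?m}. t v \<sigma>) / (fact 2 * fact (2 * k))"
    unfolding wedge_power.simps wedge_def t_def
    by (intro arg_cong2[where f="(/)"] sum.cong refl) (simp only: form_of_2_def add_0_right)
  ultimately show ?case by simp
qed

text \<open>Since \<open>e\<close> vanishes on all basis vectors but \<open>v 0\<close>, only
  permutations fixing \<open>0\<close> contribute, and for them the sign cancels as in the case of
  the powers of \<open>w\<close>.\<close>

lemma contact_form_darboux_pos: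
  assumes e: "e (v 0) = 1" "\<And>i. i < 2 * n \<Longrightarrow> e (v (Suc i)) = 0"
    and d: "darboux (2 * n) w (\<lambda>i. v (Suc i))"
  shows "wedge 1 (2 * n) (form_of_1 e) (wedge_power 2 (form_of_2 w) n) v > 0"
proof -
  let ?W = "wedge_power 2 (form_of_2 w) n"
  let ?m = "1 + 2 * n"
  define t where "t \<sigma> = of_int (sign \<sigma>) * e (v (\<sigma> 0)) * ?W (\<lambda>i. v (\<sigma> (1 + i)))" for \<sigma>
  have W: "?W (\<lambda>i. v (1 + i)) > 0"
    using wedge_power_darboux_pos[OF d] by simp
  have pos: "t \<sigma> > 0" if s: "\<sigma> permutes {..<?m}" and s0: "\<sigma> 0 = 0" for \<sigma>
  proof -
    have "\<sigma> permutes {1..<?m}"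
      by (rule permutes_superset[OF s]) (use s0 in \<open>auto simp: not_le\<close>)
    then have "?W (\<lambda>i. v (\<sigma> (1 + i))) = of_int (sign \<sigma>) * ?W (\<lambda>i. v (1 + i))"
      by (rule skew_form_shift[OF skew_wedge_power])
    moreover have "of_int (sign \<sigma>) * (of_int (sign \<sigma>) * x) = x" for x :: real
      by (simp flip: of_int_mult add: mult.assoc[symmetric])
    ultimately show ?thesis
      unfolding t_def s0 using W by (simp only: e(1) mult_1_right)
  qed
  have nonneg: "t \<sigma> \<ge> 0" if s: "\<sigma> permutes {..<?m}" for \<sigma>
  proof (cases "\<sigma> 0")
    case 0
    then show ?thesis using pos[OF s] by simp
  next
    case (Suc i)
    then have "e (v (\<sigma> 0)) = 0"
      using permutes_in_image[OF s, of 0] e(2) by simp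
    then show ?thesis by (simp add: t_def)
  qed
  have "(\<Sum>\<sigma> | \<sigma> permutes {..<?m}. t \<sigma>) > 0"
    by (rule sum_pos2[where i=id])
      (use nonneg pos in \<open>auto simp: finite_permutations permutes_id\<close>)
  then show ?thesis
    by (simp add: wedge_def t_def form_of_1_def)
qed

text \<open>Evaluates an expansion along pairs at a single index: only the pair
  \<open>i div 2\<close> can survive, and the parity of \<open>i\<close> selects the
  coefficient.\<close>

lemma sum_if_pairs:
  fixes f g :: "nat \<Rightarrow> real"
  shows "(\<Sum>j<k. f j * (if i = 2 * j then 1 else 0) + g j * (if i = Suc (2 * j) then 1 else 0)) =
    (if i < 2 * k then (if even i then f (i div 2) else g (i div 2)) else 0)"
  proof (induction k)
  case (Suc k)
  consider "i < 2 * k" | "i = 2 * k" | "i = Suc (2 * k)" | "i > Suc (2 * k)" by linarith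
  then show ?case
    by cases (simp_all add: Suc.IH)
qed simp

text \<open>\<open>w\<close> is nondegenerate on the span of a Darboux family, so every vector has a
  projection onto that span along the \<open>w\<close>-orthogonal complement.\<close>

lemma darboux_orthogonal_projection:
  fixes w :: "'a::real_vector \<Rightarrow> 'a \<Rightarrow> real"
  assumes w: "two_form w" and d: "darboux (2 * k) w v"
  obtains s where "s \<in> span (v ` {..<2 * k})" "\<And>i. i < 2 * k \<Longrightarrow> w (x - s) (v i) = 0"
proof
  have bl: "bilinear w"
    using w unfolding two_form_def by simp
  \<comment> \<open>The coefficients are forced by
    \<open>w (v (2 * j)) (v (Suc (2 * j))) = 1\<close>: each one pairs \<open>x\<close> with the
    partner of the basis vector, with a minus sign for odd indices.\<close>
  let ?s = "\<Sum>j<k. w x (v (Suc (2 * j))) *\<^sub>R v (2 * j) - w x (v (2 * j)) *\<^sub>R v (Suc (2 * j))"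
  show "?s \<in> span (v ` {..<2 * k})"
    by (intro span_sum span_diff span_scale span_base) auto
  fix i assume i: "i < 2 * k"
  have lin: "linear (\<lambda>y. w y (v i))"
    using bl unfolding bilinear_def by simp
  have "w ?s (v i) = (\<Sum>j<k. w x (v (Suc (2 * j))) * w (v (2 * j)) (v i)
      - w x (v (2 * j)) * w (v (Suc (2 * j))) (v i))"
    by (simp add: linear_sum[OF lin] linear_diff[OF lin] linear_cmul[OF lin])
  also have "\<dots> = (\<Sum>j<k. w x (v (2 * j)) * (if i = 2 * j then 1 else 0)
      + w x (v (Suc (2 * j))) * (if i = Suc (2 * j) then 1 else 0))"
  proof (rule sum.cong)
    fix j assume "j \<in> {..<k}"
    then have "2 * j < 2 * k" "Suc (2 * j) < 2 * k" by auto
    then show "w x (v (Suc (2 * j))) * w (v (2 * j)) (v i) - w x (v (2 * j)) * w (v (Suc (2 * j))) (v i)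
      = w x (v (2 * j)) * (if i = 2 * j then 1 else 0)
        + w x (v (Suc (2 * j))) * (if i = Suc (2 * j) then 1 else 0)"
      using darbouxD[OF d _ i] by auto
  qed simp
  also have "\<dots> = w x (v i)"
    unfolding sum_if_pairs using i by auto
  finally show "w (x - ?s) (v i) = 0"
    by (simp add: bilinear_lsub[OF bl])
qed

text \<open>Symplectic Gram-Schmidt, adding one pair at a time.\<close>

lemma darboux_exists:
  fixes w :: "'a::real_vector \<Rightarrow> 'a \<Rightarrow> real"
  assumes dim: "has_dimension TYPE('a) (2 * n)" and w: "two_form w" and nd: "nondegenerate w"
  shows "\<exists>v. darboux (2 * n) w v"
proof -
  have bl: "bilinear w" and alt: "\<And>x. w x x = 0"
    using w unfolding two_form_def by auto
  have "k \<le> n \<Longrightarrow> \<exists>v. darboux (2 * k) w v" for k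
  proof (induction k)
    case 0
    then show ?case by (simp add: darboux_def)
  next
    case (Suc k)
    then obtain v where d: "darboux (2 * k) w v" by auto
    \<comment> \<open>For \<open>k < n\<close> these vectors are too few to span, which leaves an
      \<open>x\<close> outside whose orthogonal part \<open>x - s\<close> is not zero.\<close>
    have "card (v ` {..<2 * k}) \<le> 2 * k"
      using card_image_le[of "{..<2 * k}" v] by simp
    then have "span (v ` {..<2 * k}) \<noteq> UNIV"
      using has_dimension_span_ge[OF dim, of "v ` {..<2 * k}"] Suc.prems by auto
    then obtain x where x: "x \<notin> span (v ` {..<2 * k})" by blast
    obtain s where s: "s \<in> span (v ` {..<2 * k})" "\<And>i. i < 2 * k \<Longrightarrow> w (x - s) (v i) = 0"
      by (rule darboux_orthogonal_projection[OF w d, of x]) blast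
    let ?x = "x - s"
    have "?x \<noteq> 0"
      using x s(1) by auto
    then obtain y where y: "w ?x y \<noteq> 0"
      using nd unfolding nondegenerate_def by blast
    obtain r where r: "r \<in> span (v ` {..<2 * k})" "\<And>i. i < 2 * k \<Longrightarrow> w (y - r) (v i) = 0"
      by (rule darboux_orthogonal_projection[OF w d, of y]) blast
    have "linear (w ?x)"
      using bl unfolding bilinear_def by simp
    \<comment> \<open>\<open>?x\<close> is orthogonal to the family and hence to \<open>r\<close>,
      so removing \<open>r\<close> from \<open>y\<close> keeps \<open>w ?x y\<close>; rescaling
      makes the pairing \<open>1\<close>.\<close>
    then have "w ?x r = 0"
      using r(1) s(2) linear_eq_0_on_span[of "w ?x" "v ` {..<2 * k}" r] by auto
    define z where "z = (1 / w ?x y) *\<^sub>R (y - r)"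
    have xz: "w ?x z = 1"
      using y \<open>w ?x r = 0\<close> unfolding z_def by (simp add: bilinear_rmul[OF bl] bilinear_rsub[OF bl])
    have z: "w z (v i) = 0" if "i < 2 * k" for i
      using r(2)[OF that] unfolding z_def by (simp add: bilinear_lmul[OF bl])
    have sw: "w (v i) ?x = 0" "w (v i) z = 0" if "i < 2 * k" for i
      using s(2)[OF that] z[OF that] two_form_swap[OF w] by (metis neg_0_equal_iff_equal)+
    have zx: "w z ?x = - 1"
      using xz two_form_swap[OF w] by metis
    define u where "u = v(2 * k := ?x, Suc (2 * k) := z)"
    have "darboux (2 * Suc k) w u"
      unfolding darboux_def
    proof (intro allI impI)
      fix i j assume ij: "i < 2 * Suc k" "j < 2 * Suc k"
      show "w (u i) (u j) =
          (if even i \<and> j = Suc i then 1 else if odd i \<and> i = Suc j then - 1 else 0)"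
      proof (cases "i < 2 * k")
        case True
        then have ui: "u i = v i"
          by (simp add: u_def)
        have par: "\<not> (even i \<and> 2 * k = Suc i)"
          by presburger
        consider "j < 2 * k" | "j = 2 * k" | "j = Suc (2 * k)" using ij(2) by fastforce
        then show ?thesis
        proof cases
          case 1
          then have "u j = v j"
            by (simp add: u_def)
          then show ?thesis
            using darbouxD[OF d True 1] by (simp only: ui)
        next
          case 2
          then show ?thesis
            using True par sw[OF True] by (auto simp: u_def ui)
        next
          case 3
          then show ?thesis
            using True sw[OF True] by (auto simp: u_def ui)
        qed
      next
        case False
        have i: "i = 2 * k \<or> i = Suc (2 * k)" and j: "j < 2 * k \<or> j = 2 * k \<or> j = Suc (2 * k)"
          using False ij by auto
        show ?thesis
          using i j s(2)[of j] z[of j] xz zx alt by (elim disjE) (auto simp: u_def)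
      qed
    qed
    then show ?case by blast
  qed
  then show ?thesis by blast
qed


section \<open>Splittings off a line\<close>

text \<open>\<open>'a\<close> is the sum of the kernel of \<open>e\<close> and the line through
  \<open>x\<close>. The map \<open>s\<close> identifies \<open>'b\<close> with that kernel, and
  \<open>p\<close> is the projection along \<open>x\<close>.\<close>

locale splitting =
  fixes e :: "'a::real_vector \<Rightarrow> real" and x :: 'a
    and p :: "'a \<Rightarrow> 'b::real_vector" and s :: "'b \<Rightarrow> 'a"
  assumes lin_e: "linear e" and lin_p: "linear p" and lin_s: "linear s"
    and p_s [simp]: "p (s Y) = Y" and e_s [simp]: "e (s Y) = 0"
    and p_x [simp]: "p x = 0" and e_x [simp]: "e x = 1"
    and decomp: "s (p X) + e X *\<^sub>R x = X"
begin

lemmas p_simps [simp] = linear_add[OF lin_p] linear_diff[OF lin_p] linear_neg[OF lin_p]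
  linear_cmul[OF lin_p] linear_0[OF lin_p]
lemmas e_simps [simp] = linear_add[OF lin_e] linear_diff[OF lin_e] linear_neg[OF lin_e]
  linear_cmul[OF lin_e] linear_0[OF lin_e]
lemmas s_simps [simp] = linear_add[OF lin_s] linear_diff[OF lin_s] linear_neg[OF lin_s]
  linear_cmul[OF lin_s] linear_0[OF lin_s]

text \<open>Reduces an identity in \<open>'a\<close> to one in \<open>'b\<close> and one between
  numbers; most later verifications rest on it.\<close>

lemma split_eqI: "p X = p Y \<Longrightarrow> e X = e Y \<Longrightarrow> X = Y"
  by (metis decomp)

end

text \<open>A basis of the kernel of \<open>e\<close> becomes a basis of \<open>'a\<close> when
  \<open>x\<close> is added, so it has \<open>m\<close> elements and can be matched with a basis of
  \<open>'b\<close>.\<close>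

lemma splitting_exists:
  fixes e :: "'a::real_vector \<Rightarrow> real"
  assumes da: "has_dimension TYPE('a) (m + 1)" and db: "has_dimension TYPE('b::real_vector) m"
    and e: "linear e" and x: "e x = 1"
  shows "\<exists>(p :: 'a \<Rightarrow> 'b) s. splitting e x p s"
proof -
  obtain B where B: "B \<subseteq> {y. e y = 0}" "independent B" "{y. e y = 0} \<subseteq> span B"
    by (rule maximal_independent_subset)
  have eB: "e y = 0" if "y \<in> span B" for y
    using linear_eq_0_on_span[OF e, of B y] B(1) that by auto
  have xB: "x \<notin> span B"
    using eB x by auto
  then have xB': "x \<notin> B"
    using span_base by blast
  have fB: "finite B"
    using has_dimension_independent_card(1)[OF da B(2)] .
  have "span (insert x B) = UNIV"
  proof -
    have "y - e y *\<^sub>R x \<in> span B" for y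
      using B(3) x by (auto simp: linear_diff[OF e] linear_cmul[OF e])
    then show ?thesis
      using span_breakdown_eq[of _ x B] by blast
  qed
  then have "m + 1 \<le> card (insert x B)"
    using has_dimension_span_ge[OF da] fB by blast
  moreover have "card (insert x B) \<le> m + 1"
    by (rule has_dimension_independent_card(2)[OF da independent_insertI[OF xB B(2)]])
  ultimately have cB: "card B = m"
    using fB xB' by simp
  obtain C :: "'b set" where C: "finite C" "card C = m" "independent C" "span C = UNIV"
    using db unfolding has_dimension_def by blast
  obtain h where h: "bij_betw h C B"
    using finite_same_card_bij[OF C(1) fB] C(2) cB by auto
  obtain s where s: "linear s" "\<And>c. c \<in> C \<Longrightarrow> s c = h c"
    using linear_independent_extend[OF C(3), of h] by blast
  \<comment> \<open>\<open>p\<close> is prescribed on the basis \<open>insert x B\<close>: it kills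
    \<open>x\<close> and inverts the matching \<open>h\<close> on \<open>B\<close>. The splitting
    identities then need checking on bases only.\<close>
  obtain p where p: "linear p" and px: "p x = 0" and pB: "\<And>y. y \<in> B \<Longrightarrow> p y = inv_into C h y"
  proof -
    obtain p where p: "linear p" "\<And>y. y \<in> insert x B \<Longrightarrow> p y = (if y = x then 0 else inv_into C h y)"
      using linear_independent_extend[OF independent_insertI[OF xB B(2)],
          of "\<lambda>y. if y = x then 0 else inv_into C h y"] by blast
    have "p y = inv_into C h y" if "y \<in> B" for y
      using p(2)[of y] that xB' by (cases "y = x") simp_all
    then show ?thesis
      using that[OF p(1)] p(2)[of x] by simp
  qed
  have hC: "h c \<in> B" if "c \<in> C" for c
    using h that bij_betwE by blast
  have ps: "p (s Y) = Y" for Y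
  proof (rule real_vector.linear_eq_on[where f="\<lambda>Y. p (s Y)" and g="\<lambda>Y. Y" and B=C])
    show "linear (\<lambda>Y. p (s Y))"
      using linear_compose[OF s(1) p] by (simp add: o_def)
    show "p (s c) = c" if "c \<in> C" for c
      using s(2)[OF that] pB[OF hC[OF that]] bij_betw_inv_into_left[OF h that] by simp
    show "Y \<in> span C"
      by (simp add: C(4))
  qed (rule linear_ident)
  have es: "e (s Y) = 0" for Y
  proof (rule linear_eq_0_on_span[where b=C])
    show "linear (\<lambda>Y. e (s Y))"
      using linear_compose[OF s(1) e] by (simp add: o_def)
    show "e (s c) = 0" if "c \<in> C" for c
      using s(2)[OF that] hC[OF that] B(1) by auto
    show "Y \<in> span C"
      by (simp add: C(4))
  qed
  have dec: "s (p X) + e X *\<^sub>R x = X" for X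
  proof (rule real_vector.linear_eq_on[where f="\<lambda>X. s (p X) + e X *\<^sub>R x" and g="\<lambda>X. X" and B="insert x B"])
    show "linear (\<lambda>X. s (p X) + e X *\<^sub>R x)"
      using s(1) p e by (simp add: linear_iff algebra_simps)
    show "s (p y) + e y *\<^sub>R x = y" if "y \<in> insert x B" for y
    proof (cases "y = x")
      case True
      then show ?thesis using px x linear_0[OF s(1)] by simp
    next
      case False
      then have y: "y \<in> B" using that by simp
      then have "inv_into C h y \<in> C" "h (inv_into C h y) = y"
        using h unfolding bij_betw_def by (metis inv_into_into, metis f_inv_into_f)
      then show ?thesis
        using pB[OF y] s(2)[of "inv_into C h y"] B(1) y by auto
    qed
    show "X \<in> span (insert x B)"
      by (simp add: \<open>span (insert x B) = UNIV\<close>)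
  qed (rule linear_ident)
  have "splitting e x p s"
    by (intro splitting.intro e s(1) p ps es px x dec)
  then show ?thesis by blast
qed

text \<open>Supplies \<open>\<eta>\<close> and \<open>\<xi>\<close> when a contact algebra is built
  from a Kaehler one. Positive dimension makes the basis nonempty, and the covector equal to
  \<open>1\<close> on a basis will do.\<close>

lemma has_dimension_covector:
  assumes "has_dimension TYPE('a::real_vector) (m + 1)"
  obtains e :: "'a::real_vector \<Rightarrow> real" and x where "linear e" "e x = 1"
proof -
  obtain B :: "'a set" where B: "independent B" "card B = m + 1"
    using assms unfolding has_dimension_def by blast
  then obtain x where "x \<in> B"
    by fastforce
  then show ?thesis
    using linear_independent_extend[OF B(1), of "\<lambda>_. 1 :: real"] that by blast
qed


section \<open>Central extensions\<close>

text \<open>Relates the structure maps only and assumes no axioms for \<open>G\<close> or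
  \<open>H\<close>, so that axioms can be carried in both directions. The minus sign comes from
  \<open>d\<eta>(X, Y) = -\<eta>([X, Y])\<close>.\<close>

locale central_extension = splitting "eta G" "xi G" p s
  for G :: "'a::real_vector acm_lie" and H :: "'b::real_vector kaehler_lie"
    and p :: "'a \<Rightarrow> 'b" and s :: "'b \<Rightarrow> 'a" +
  assumes br_G: "br G X Y = s (br H (p X) (p Y)) - symp H (p X) (p Y) *\<^sub>R xi G"
    and phi_G: "phi G X = s (cpx H (p X))"
    and met_G: "met G X Y = met H (p X) (p Y) + eta G X * eta G Y"

lemma lie_bracket_swap:
  assumes "lie_bracket b"
  shows "b X Y = - b Y X"
proof -
  have bl: "bilinear b" and alt: "\<And>Z. b Z Z = 0"
    using assms unfolding lie_bracket_def by auto
  have "b (X + Y) (X + Y) = b X Y + b Y X"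
    by (simp add: bilinear_ladd[OF bl] bilinear_radd[OF bl] alt[of X] alt[of Y])
  then show ?thesis
    using alt[of "X + Y"] by (simp add: eq_neg_iff_add_eq_0)
qed

text \<open>In this form \<open>d\<omega>\<close> matches, up to sign, the
  \<open>\<xi>\<close>-component of the Jacobi sum term by term.\<close>

lemma d2_cyclic:
  assumes b: "lie_bracket b" and w: "two_form w"
  shows "d2 b w X Y Z = w X (b Y Z) + w Y (b Z X) + w Z (b X Y)"
proof -
  have "w Y (b Z X) = - w Y (b X Z)"
    using w lie_bracket_swap[OF b, of Z X] unfolding two_form_def by (metis bilinear_rneg)
  then show ?thesis
    unfolding d2_def
    using two_form_swap[OF w, of "b X Y" Z] two_form_swap[OF w, of "b X Z" Y]
      two_form_swap[OF w, of "b Y Z" X] by simp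
qed

section \<open>From the quotient to the extension\<close>

context central_extension
begin

lemma p_br [simp]: "p (br G X Y) = br H (p X) (p Y)"
  by (simp add: br_G)

lemma e_br [simp]: "eta G (br G X Y) = - symp H (p X) (p Y)"
  by (simp add: br_G)

lemma p_phi [simp]: "p (phi G X) = cpx H (p X)"
  by (simp add: phi_G)

lemma e_phi [simp]: "eta G (phi G X) = 0"
  by (simp add: phi_G)

lemma d_eta_eq: "d_eta G X Y = symp H (p X) (p Y)"
  by (simp add: d_eta_def d1_def)

lemma fundamental_form_eq: "fundamental_form G X Y = met H (p X) (cpx H (p Y))"
  by (simp add: fundamental_form_def met_G)

lemma p_N_phi: "p (N_phi G X Y) =
    br H (cpx H (p X)) (cpx H (p Y)) + cpx H (cpx H (br H (p X) (p Y)))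
    - cpx H (br H (p X) (cpx H (p Y))) - cpx H (br H (cpx H (p X)) (p Y))"
  by (simp add: N_phi_def)

lemma br_H: "br H X Y = p (br G (s X) (s Y))"
  by simp

lemma symp_H: "symp H X Y = - eta G (br G (s X) (s Y))"
  by simp

lemma met_H: "met H X Y = met G (s X) (s Y)"
  by (simp add: met_G)

lemma cpx_H: "cpx H X = p (phi G (s X))"
  by simp

text \<open>The kernel of \<open>p\<close> is central by the bracket formula. Conversely, if
  \<open>X\<close> is central, the \<open>\<xi>\<close>-component of its brackets puts
  \<open>p X\<close> in the radical of \<omega>, which is zero.\<close>

lemma central_quotientI:
  assumes "bilinear (br H)" "bilinear (symp H)" "nondegenerate (symp H)"
  shows "central_quotient G H"
proof -
  have "surj p"
    by (metis p_s surjI)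
  moreover have "{X. p X = 0} = lie_center (br G)"
  proof (intro set_eqI iffI)
    fix X assume "X \<in> {X. p X = 0}"
    then show "X \<in> lie_center (br G)"
      by (simp add: lie_center_def br_G bilinear_lzero[OF assms(1)] bilinear_lzero[OF assms(2)])
  next
    fix X assume "X \<in> lie_center (br G)"
    then have "br G X (s Y) = 0" for Y
      by (simp add: lie_center_def)
    then have "symp H (p X) Y = 0" for Y
      by (metis e_br p_s e_simps(5) neg_equal_0_iff_equal)
    then show "X \<in> {X. p X = 0}"
      using assms(3) by (simp add: nondegenerate_def)
  qed
  ultimately show ?thesis
    unfolding central_quotient_def
    by (intro exI[of _ p]) (simp add: lin_p met_G d_eta_eq)
qed

lemma kaehler_imp_contact:
  assumes da: "has_dimension TYPE('a) (2 * n + 1)" and H: "H \<in> kaehler_symplectic n"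
  shows "G \<in> tk_max_rank_center n"
proof -
  have lie: "lie_bracket (br H)" and ip: "inner_product (met H)" and lin_J: "linear (cpx H)"
    and J: "\<And>X. cpx H (cpx H X) = - X"
    and N: "\<And>X Y. br H (cpx H X) (cpx H Y) - br H X Y
            - cpx H (br H (cpx H X) Y) - cpx H (br H X (cpx H Y)) = 0"
    and JJ: "\<And>X Y. met H (cpx H X) (cpx H Y) = met H X Y"
    and Om: "\<And>X Y Z. d2 (br H) (\<lambda>X Y. met H X (cpx H Y)) X Y Z = 0"
    and w: "two_form (symp H)" and dw: "\<And>X Y Z. d2 (br H) (symp H) X Y Z = 0"
    and nd: "nondegenerate (symp H)" and db: "has_dimension TYPE('b) (2 * n)"
    using H unfolding kaehler_symplectic_def mem_Collect_eq Kaehler_lie_algebra_def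
      symplectic_form_def closed_two_form_def by blast+
  have bl: "bilinear (br H)" and blw: "bilinear (symp H)" and blm: "bilinear (met H)"
    using lie w ip unfolding lie_bracket_def two_form_def inner_product_def by auto
  note bil = bilinear_ladd[OF bl] bilinear_radd[OF bl] bilinear_lmul[OF bl] bilinear_rmul[OF bl]
    bilinear_ladd[OF blw] bilinear_radd[OF blw] bilinear_lmul[OF blw] bilinear_rmul[OF blw]
    bilinear_ladd[OF blm] bilinear_radd[OF blm] bilinear_lmul[OF blm] bilinear_rmul[OF blm]
    bilinear_lzero[OF bl] bilinear_lzero[OF blw]
    linear_0[OF lin_J] linear_add[OF lin_J] linear_cmul[OF lin_J]
  have "lie_bracket (br G)"
    unfolding lie_bracket_def
  proof (intro conjI allI)
    show "bilinear (br G)"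
      unfolding bilinear_def linear_iff
      by (intro conjI allI; rule split_eqI) (simp_all add: bil)
    show "br G X X = 0" for X
      by (rule split_eqI) (use lie w in \<open>simp_all add: lie_bracket_def two_form_def\<close>)
    show "br G X (br G Y Z) + br G Y (br G Z X) + br G Z (br G X Y) = 0" for X Y Z
    proof (rule split_eqI)
      show "p (br G X (br G Y Z) + br G Y (br G Z X) + br G Z (br G X Y)) = p 0"
        using lie by (simp add: lie_bracket_def)
      show "eta G (br G X (br G Y Z) + br G Y (br G Z X) + br G Z (br G X Y)) = eta G 0"
        using dw[of "p X" "p Y" "p Z"] d2_cyclic[OF lie w, of "p X" "p Y" "p Z"] by simp
    qed
  qed
  moreover have "inner_product (met G)"
    unfolding inner_product_def
  proof (intro conjI allI impI)
    show "bilinear (met G)"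
      unfolding bilinear_def linear_iff by (simp add: met_G bil algebra_simps)
    show "met G X Y = met G Y X" for X Y
      using ip by (simp add: met_G inner_product_def)
    fix X :: 'a assume "X \<noteq> 0"
    then have "p X \<noteq> 0 \<or> eta G X \<noteq> 0"
      using split_eqI[of X 0] by auto
    moreover have pos: "p X \<noteq> 0 \<Longrightarrow> met H (p X) (p X) > 0"
      using ip unfolding inner_product_def by blast
    moreover have "met H (p X) (p X) \<ge> 0"
      using pos bilinear_lzero[OF blm, of 0] by (cases "p X = 0") auto
    ultimately show "met G X X > 0"
      unfolding met_G by (metis add_nonneg_pos add_pos_nonneg not_real_square_gt_zero zero_le_square)
  qed
  moreover have "linear (phi G)"
    unfolding linear_iff by (simp add: phi_G bil)
  moreover have "phi G (phi G X) = - X + eta G X *\<^sub>R xi G" for X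
    by (rule split_eqI) (simp_all add: J)
  moreover have "met G (phi G X) (phi G Y) = met G X Y - eta G X * eta G Y" for X Y
    by (simp add: met_G JJ)
  ultimately have acm: "almost_contact_metric n G"
    unfolding almost_contact_metric_def using da lin_e by simp
  \<comment> \<open>\<open>J\<close> squares to \<open>-I\<close>, which turns the term with
    \<open>phi\<close> applied twice into \<open>- br H (p X) (p Y)\<close> and leaves the Nijenhuis
    tensor of \<open>J\<close>.\<close>
  have N0: "p (N_phi G X Y) = 0" for X Y
    using N[of "p X" "p Y"] unfolding p_N_phi J by (simp add: algebra_simps)
  have "N_phi G (xi G) X = 0" for X
    by (rule split_eqI) (simp_all add: N0 N_phi_def d_eta_eq bil)
  moreover have "d2 (br G) (fundamental_form G) X Y Z = 0" for X Y Z
    using Om[of "p X" "p Y" "p Z"] by (simp add: d2_def fundamental_form_eq)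
  moreover have "met G (N_phi G X Y) Z = 0" if "eta G Z = 0" for X Y Z
    using that by (simp add: met_G N0 bilinear_lzero[OF blm])
  ultimately have tk: "transversely_Kaehler G"
    unfolding transversely_Kaehler_def by blast
  obtain v where v: "darboux (2 * n) (symp H) v"
    using darboux_exists[OF db w nd] by blast
  \<comment> \<open>The lift of a Darboux basis lies in \<open>ker \<eta>\<close>; with
    \<open>xi G\<close> put in front of it, the contact form can be evaluated.\<close>
  have "darboux (2 * n) (d_eta G) (\<lambda>i. s (v i))"
    using v unfolding darboux_def by (simp add: d_eta_eq)
  then have "wedge 1 (2 * n) (form_of_1 (eta G)) (wedge_power 2 (form_of_2 (d_eta G)) n)
      (case_nat (xi G) (\<lambda>i. s (v i))) > 0"
    by (intro contact_form_darboux_pos) simp_all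
  then have mr: "maximal_rank n G"
    unfolding maximal_rank_def by (metis less_irrefl)
  have "xi G \<noteq> 0"
    using e_x e_simps(5) by (metis zero_neq_one)
  moreover have "xi G \<in> lie_center (br G)"
    by (simp add: lie_center_def br_G bil)
  ultimately have "lie_center (br G) \<noteq> {0}"
    by blast
  then show ?thesis
    using acm tk mr by (simp add: tk_max_rank_center_def)
qed

end

section \<open>From the extension to the quotient\<close>

lemma d_eta_two_form:
  assumes "lie_bracket (br G)" "linear (eta G)"
  shows "two_form (d_eta G)"
  using assms unfolding two_form_def d_eta_def d1_def lie_bracket_def bilinear_def linear_iff
  by (simp add: linear_0[OF assms(2)])

context central_extension
begin

lemma contact_imp_kaehler:
  assumes db: "has_dimension TYPE('b) (2 * n)" and G: "G \<in> tk_max_rank_center n"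
  shows "H \<in> kaehler_symplectic n"
proof -
  have lieG: "lie_bracket (br G)" and ip: "inner_product (met G)" and lin_phi: "linear (phi G)"
    and phi2: "\<And>X. phi G (phi G X) = - X + eta G X *\<^sub>R xi G"
    and phi_met: "\<And>X Y. met G (phi G X) (phi G Y) = met G X Y - eta G X * eta G Y"
    and Phi: "\<And>X Y Z. d2 (br G) (fundamental_form G) X Y Z = 0"
    and N: "\<And>X Y Z. eta G X = 0 \<Longrightarrow> eta G Y = 0 \<Longrightarrow> eta G Z = 0 \<Longrightarrow> met G (N_phi G X Y) Z = 0"
    and mr: "maximal_rank n G" and da: "has_dimension TYPE('a) (2 * n + 1)"
    using G unfolding tk_max_rank_center_def mem_Collect_eq almost_contact_metric_def
      transversely_Kaehler_def by blast+
  have bl: "bilinear (br G)" and blm: "bilinear (met G)"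
    and alt: "\<And>X. br G X X = 0"
    and jac: "\<And>X Y Z. br G X (br G Y Z) + br G Y (br G Z X) + br G Z (br G X Y) = 0"
    using lieG ip unfolding lie_bracket_def inner_product_def by auto
  note bil = bilinear_ladd[OF bl] bilinear_radd[OF bl] bilinear_lmul[OF bl] bilinear_rmul[OF bl]
    bilinear_ladd[OF blm] bilinear_radd[OF blm] bilinear_lmul[OF blm] bilinear_rmul[OF blm]
    linear_add[OF lin_phi] linear_cmul[OF lin_phi]
  \<comment> \<open>\<open>br_H\<close> expresses the bracket of \<open>H\<close> by that of
    \<open>G\<close>. The simp rule \<open>p_br\<close> would undo this and is removed; the same is
    done for the other maps.\<close>
  have "bilinear (br H)"
    unfolding bilinear_def linear_iff br_H by (simp del: p_br add: bil)
  moreover have "br H X X = 0" for X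
    unfolding br_H by (simp del: p_br add: alt)
  moreover have "br H X (br H Y Z) + br H Y (br H Z X) + br H Z (br H X Y) = 0" for X Y Z
    using arg_cong[where f=p, OF jac[of "s X" "s Y" "s Z"]] by simp
  ultimately have lie: "lie_bracket (br H)"
    unfolding lie_bracket_def by blast
  have ipH: "inner_product (met H)"
    unfolding inner_product_def
  proof (intro conjI allI impI)
    show "bilinear (met H)"
      unfolding bilinear_def linear_iff met_H by (simp add: bil)
    show "met H X Y = met H Y X" for X Y
      using ip by (simp add: met_H inner_product_def)
    fix X :: 'b assume "X \<noteq> 0"
    then have "s X \<noteq> 0"
      using p_s[of X] by (metis p_simps(5))
    then show "met H X X > 0"
      using ip by (simp add: met_H inner_product_def)
  qed
  have blH: "bilinear (met H)" and symH: "\<And>X Y. met H X Y = met H Y X"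
    and posH: "\<And>X. met H X X = 0 \<Longrightarrow> X = 0"
    using ipH unfolding inner_product_def by (auto simp: less_le)
  have lin_J: "linear (cpx H)"
    unfolding linear_iff cpx_H by (simp del: p_phi add: bil)
  have J: "cpx H (cpx H X) = - X" for X
    using arg_cong[where f=p, OF phi2[of "s X"]] by simp
  have JJ: "met H (cpx H X) (cpx H Y) = met H X Y" for X Y
    using phi_met[of "s X" "s Y"] by (simp add: met_G)
  have NH: "br H (cpx H X) (cpx H Y) - br H X Y
            - cpx H (br H (cpx H X) Y) - cpx H (br H X (cpx H Y)) = 0" for X Y
  proof -
    have "met H (p (N_phi G (s X) (s Y))) (p (N_phi G (s X) (s Y))) = 0"
      \<comment> \<open>The hypothesis tests \<open>N_phi\<close> only against
        \<open>ker \<eta>\<close>. Testing against the lift of its own projection gives a squared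
        norm.\<close>
      using N[of "s X" "s Y" "s (p (N_phi G (s X) (s Y)))"] by (simp add: met_G)
    then have "p (N_phi G (s X) (s Y)) = 0"
      by (rule posH)
    then show ?thesis
      unfolding p_N_phi by (simp add: J algebra_simps)
  qed
  have "two_form (\<lambda>X Y. met H X (cpx H Y))"
    unfolding two_form_def
  proof (intro conjI allI)
    show "bilinear (\<lambda>X Y. met H X (cpx H Y))"
      using blH lin_J unfolding bilinear_def linear_iff by simp
    show "met H X (cpx H X) = 0" for X
      using JJ[of X "cpx H X"] symH[of X "cpx H X"] by (simp add: J bilinear_rneg[OF blH])
  qed
  moreover have "d2 (br H) (\<lambda>X Y. met H X (cpx H Y)) X Y Z = 0" for X Y Z
    using Phi[of "s X" "s Y" "s Z"] by (simp add: d2_def fundamental_form_eq)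
  moreover have "nondegenerate (\<lambda>X Y. met H X (cpx H Y))"
    unfolding nondegenerate_def
  proof (intro allI impI)
    fix X assume "\<forall>Y. met H X (cpx H Y) = 0"
    \<comment> \<open>The choice \<open>Y = J X\<close> yields minus the squared norm of
      \<open>X\<close>.\<close>
    then have "met H X (cpx H (cpx H X)) = 0" by blast
    then show "X = 0"
      by (intro posH) (simp add: J bilinear_rneg[OF blH])
  qed
  ultimately have Om: "symplectic_form (br H) (\<lambda>X Y. met H X (cpx H Y))"
    unfolding symplectic_form_def closed_two_form_def by blast
  have w: "two_form (symp H)"
    unfolding two_form_def bilinear_def linear_iff symp_H by (simp del: e_br add: bil alt)
  moreover have "d2 (br H) (symp H) X Y Z = 0" for X Y Z
    using arg_cong[where f="eta G", OF jac[of "s X" "s Y" "s Z"]]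
    by (simp add: d2_cyclic[OF lie w])
  moreover have "nondegenerate (symp H)"
    unfolding nondegenerate_def
  proof (intro allI impI)
    fix X assume X: "\<forall>Y. symp H X Y = 0"
    obtain v where "wedge 1 (2 * n) (form_of_1 (eta G)) (wedge_power 2 (form_of_2 (d_eta G)) n) v \<noteq> 0"
      using mr unfolding maximal_rank_def by blast
    \<comment> \<open>A vector in the radical of \<omega> lifts to one in \<open>ker \<eta>\<close>
      that is annihilated by \<open>d\<eta>\<close>.\<close>
    then have "s X = 0"
      by (rule contact_nondegenerate[OF da lin_e d_eta_two_form[OF lieG lin_e]])
        (use X in \<open>simp_all add: d_eta_eq\<close>)
    then show "X = 0"
      by (metis p_s p_simps(5))
  qed
  ultimately have "symplectic_form (br H) (symp H)"
    unfolding symplectic_form_def closed_two_form_def by blast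
  then show ?thesis
    unfolding kaehler_symplectic_def Kaehler_lie_algebra_def
    using db lie ipH lin_J J JJ NH Om by simp
qed

end

text \<open>An isomorphism upstairs preserves \<xi> and \<eta>, hence the splitting, and descends.
  One downstairs extends by sending \<xi> to \<xi>, since the bracket, \<open>phi\<close> and the
  metric of \<open>G\<close> are determined by \<open>H\<close> and the splitting.\<close>

lemma central_extension_iso_iff:
  assumes "central_extension G H p s" "central_extension G' H' p' s'"
  shows "acm_isomorphic G G' \<longleftrightarrow> kaehler_isomorphic H H'"
proof -
  interpret a: central_extension G H p s by fact
  interpret b: central_extension G' H' p' s' by fact
  show ?thesis
  proof
    assume "acm_isomorphic G G'"
    then obtain F where F: "linear F" "bij F" "\<And>X Y. F (br G X Y) = br G' (F X) (F Y)"
      "\<And>X. F (phi G X) = phi G' (F X)" "F (xi G) = xi G'" "\<And>X. eta G' (F X) = eta G X"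
      "\<And>X Y. met G' (F X) (F Y) = met G X Y"
      unfolding acm_isomorphic_def by blast
    define f where "f = p' \<circ> F \<circ> s"
    \<comment> \<open>Two lifts of \<open>p X\<close> differ by a multiple of \<open>xi G\<close>,
      which \<open>F\<close> sends into the kernel of \<open>p'\<close>.\<close>
    have fp: "f (p X) = p' (F X)" for X
    proof -
      have "p' (F X) = p' (F (s (p X) + eta G X *\<^sub>R xi G))"
        by (simp add: a.decomp)
      also have "\<dots> = f (p X)"
        by (simp add: linear_add[OF F(1)] linear_cmul[OF F(1)] F(5) f_def)
      finally show ?thesis ..
    qed
    have Fs: "F (s Y) = s' (f Y)" for Y
      by (rule b.split_eqI) (simp_all add: f_def F(6))
    have "linear f"
      unfolding f_def by (intro linear_compose a.lin_s F(1) b.lin_p)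
    moreover have "bij f"
    proof (rule bijI)
      show "inj f"
        by (rule injI) (metis Fs F(2) bij_is_inj injD a.p_s)
      show "surj f"
        by (rule surjI[where f="\<lambda>Y. p (inv F (s' Y))"])
          (simp add: fp surj_f_inv_f[OF bij_is_surj[OF F(2)]])
    qed
    moreover have "f (br H X Y) = br H' (f X) (f Y)" for X Y
      using fp[of "br G (s X) (s Y)"] by (simp add: F(3) Fs)
    moreover have "f (cpx H X) = cpx H' (f X)" for X
      using fp[of "phi G (s X)"] by (simp add: F(4) Fs)
    moreover have "met H' (f X) (f Y) = met H X Y" for X Y
      using F(7)[of "s X" "s Y"] by (simp add: Fs a.met_G b.met_G)
    moreover have "symp H' (f X) (f Y) = symp H X Y" for X Y
      using F(6)[of "br G (s X) (s Y)"] by (simp add: F(3) Fs)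
    ultimately show "kaehler_isomorphic H H'"
      unfolding kaehler_isomorphic_def by blast
  next
    assume "kaehler_isomorphic H H'"
    then obtain f where f: "linear f" "bij f" "\<And>X Y. f (br H X Y) = br H' (f X) (f Y)"
      "\<And>X. f (cpx H X) = cpx H' (f X)" "\<And>X Y. met H' (f X) (f Y) = met H X Y"
      "\<And>X Y. symp H' (f X) (f Y) = symp H X Y"
      unfolding kaehler_isomorphic_def by blast
    define F where "F X = s' (f (p X)) + eta G X *\<^sub>R xi G'" for X
    have pF: "p' (F X) = f (p X)" and eF: "eta G' (F X) = eta G X" for X
      by (simp_all add: F_def)
    note lf = linear_add[OF f(1)] linear_cmul[OF f(1)] linear_0[OF f(1)]
    have "linear F"
      unfolding linear_iff by (intro conjI allI; rule b.split_eqI) (simp_all add: pF eF lf)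
    moreover have "bij F"
    proof (rule bijI)
      show "inj F"
        by (rule injI) (metis pF eF a.split_eqI f(2) bij_is_inj injD)
      show "surj F"
      proof (rule surjI)
        fix X
        show "F (s (inv f (p' X)) + eta G' X *\<^sub>R xi G) = X"
          by (rule b.split_eqI)
            (simp_all add: pF eF surj_f_inv_f[OF bij_is_surj[OF f(2)]])
      qed
    qed
    moreover have "F (br G X Y) = br G' (F X) (F Y)" for X Y
      by (rule b.split_eqI) (simp_all add: pF eF f)
    moreover have "F (phi G X) = phi G' (F X)" for X
      by (rule b.split_eqI) (simp_all add: pF eF f)
    moreover have "F (xi G) = xi G'"
      by (rule b.split_eqI) (simp_all add: pF eF lf)
    moreover have "met G' (F X) (F Y) = met G X Y" for X Y
      by (simp add: a.met_G b.met_G pF eF f)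
    ultimately show "acm_isomorphic G G'"
      unfolding acm_isomorphic_def using eF by blast
  qed
qed


section \<open>The center of a transversely Kaehler contact Lie algebra\<close>

text \<open>Standard consequences of the axioms: the definition requires none of these three
  identities.\<close>

lemma almost_contact_metric_xi:
  assumes "almost_contact_metric n G"
  shows "phi G (xi G) = 0" "eta G (phi G X) = 0" "met G X (xi G) = eta G X"
proof -
  have lin_phi: "linear (phi G)" and lin_eta: "linear (eta G)" and bl: "bilinear (met G)"
    and phi2: "\<And>X. phi G (phi G X) = - X + eta G X *\<^sub>R xi G" and e: "eta G (xi G) = 1"
    and m: "\<And>X Y. met G (phi G X) (phi G Y) = met G X Y - eta G X * eta G Y"
    using assms unfolding almost_contact_metric_def inner_product_def by auto
  have xi: "xi G \<noteq> 0"
    using e linear_0[OF lin_eta] by auto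
  have phixi: "phi G (phi G (xi G)) = 0"
    by (simp add: phi2 e)
  define c where "c = eta G (phi G (xi G))"
  have c: "phi G (xi G) = c *\<^sub>R xi G"
    \<comment> \<open>Since \<open>phi\<close> applied twice kills \<open>xi G\<close>, the first
      axiom at \<open>phi G (xi G)\<close> makes this vector a multiple \<open>c\<close> of
      \<open>xi G\<close>; applying \<open>phi\<close> again gives \<open>c * c = 0\<close>.\<close>
    using phi2[of "phi G (xi G)"] phixi linear_0[OF lin_phi] unfolding c_def
    by (simp add: eq_neg_iff_add_eq_0[symmetric])
  then have "(c * c) *\<^sub>R xi G = 0"
    using phixi by (simp add: linear_cmul[OF lin_phi])
  then show phi0: "phi G (xi G) = 0"
    using c xi by simp
  \<comment> \<open>The cube of \<open>phi\<close> is computed in two ways, from the axiom at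
    \<open>X\<close> and at \<open>phi G X\<close>; the difference is
    \<open>eta G (phi G X) *\<^sub>R xi G\<close>.\<close>
  have "phi G (phi G (phi G X)) = - phi G X"
    unfolding phi2[of X]
    by (simp add: linear_diff[OF lin_phi] linear_cmul[OF lin_phi] phi0 linear_add[OF lin_phi]
        linear_neg[OF lin_phi])
  then show "eta G (phi G X) = 0"
    using phi2[of "phi G X"] xi by simp
  show "met G X (xi G) = eta G X"
    using m[of X "xi G"] by (simp add: phi0 e bilinear_rzero[OF bl])
qed

lemma contact_center:
  assumes G: "G \<in> tk_max_rank_center n"
  shows "lie_center (br G) = range (\<lambda>c. c *\<^sub>R xi G)"
proof -
  have acm: "almost_contact_metric n G" and lie: "lie_bracket (br G)"
    and lin_phi: "linear (phi G)" and lin_eta: "linear (eta G)"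
    and phi2: "\<And>X. phi G (phi G X) = - X + eta G X *\<^sub>R xi G" and e: "eta G (xi G) = 1"
    and N: "\<And>X. eta G X = 0 \<Longrightarrow> N_phi G (xi G) X = 0"
    and mr: "maximal_rank n G" and da: "has_dimension TYPE('a) (2 * n + 1)"
    and cent: "lie_center (br G) \<noteq> {0}"
    using G unfolding tk_max_rank_center_def mem_Collect_eq almost_contact_metric_def
      transversely_Kaehler_def by blast+
  note xi = almost_contact_metric_xi[OF acm]
  have bl: "bilinear (br G)" and alt: "\<And>X. br G X X = 0"
    using lie unfolding lie_bracket_def by auto
  note le = linear_add[OF lin_eta] linear_diff[OF lin_eta] linear_neg[OF lin_eta]
    linear_cmul[OF lin_eta] linear_0[OF lin_eta]
  have reeb0: "eta G (br G (xi G) X) = 0" if "eta G X = 0" for X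
  proof -
    \<comment> \<open>In \<open>N_phi\<close> the terms with \<open>phi G (xi G)\<close> vanish, and
      the last term cancels the \<xi>-part of \<open>phi\<close> applied twice to the
      bracket.\<close>
    have "- br G (xi G) X - phi G (br G (xi G) (phi G X)) = 0"
      using N[OF that]
      by (simp add: N_phi_def xi bilinear_lzero[OF bl] linear_0[OF lin_phi] phi2 d_eta_def d1_def)
    from arg_cong[where f="eta G", OF this] show ?thesis
      by (simp add: le xi)
  qed
  have reeb: "eta G (br G (xi G) X) = 0" for X
  proof -
    have "br G (xi G) (X - eta G X *\<^sub>R xi G) = br G (xi G) X"
      by (simp add: bilinear_rsub[OF bl] bilinear_rmul[OF bl] alt)
    then show ?thesis
      using reeb0[of "X - eta G X *\<^sub>R xi G"] by (simp add: le e)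
  qed
  obtain v where v: "wedge 1 (2 * n) (form_of_1 (eta G)) (wedge_power 2 (form_of_2 (d_eta G)) n) v \<noteq> 0"
    using mr unfolding maximal_rank_def by blast
  have multiple: "Z = eta G Z *\<^sub>R xi G" if "Z \<in> lie_center (br G)" for Z
  proof -
    have "Z - eta G Z *\<^sub>R xi G = 0"
    proof (rule contact_nondegenerate[OF da lin_eta d_eta_two_form[OF lie lin_eta] v])
      show "eta G (Z - eta G Z *\<^sub>R xi G) = 0"
        by (simp add: le e)
      show "d_eta G (Z - eta G Z *\<^sub>R xi G) Y = 0" for Y
        using that reeb[of Y]
        by (simp add: d_eta_def d1_def lie_center_def bilinear_lsub[OF bl] bilinear_lmul[OF bl] le)
    qed
    then show ?thesis by simp
  qed
  have "0 \<in> lie_center (br G)"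
    by (simp add: lie_center_def bilinear_lzero[OF bl])
  \<comment> \<open>A nontrivial center contains a nonzero multiple of \<open>xi G\<close>, hence
    \<open>xi G\<close> itself.\<close>
  then obtain Z where Z: "Z \<in> lie_center (br G)" "Z \<noteq> 0"
    using cent by blast
  have "br G (eta G Z *\<^sub>R xi G) X = 0" for X
    using Z(1) multiple[OF Z(1)] by (simp add: lie_center_def)
  moreover have "eta G Z \<noteq> 0"
    using multiple[OF Z(1)] Z(2) by auto
  ultimately have "br G (xi G) X = 0" for X
    by (simp add: bilinear_lmul[OF bl])
  then have "c *\<^sub>R xi G \<in> lie_center (br G)" for c
    by (simp add: lie_center_def bilinear_lmul[OF bl])
  then show ?thesis
    using multiple by auto
qed

lemma contact_xi_simps:
  assumes G: "G \<in> tk_max_rank_center n"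
  shows "met G X (xi G) = eta G X" "phi G (xi G) = 0" "br G (xi G) X = 0" "br G X (xi G) = 0"
    "met G (xi G) X = eta G X" "eta G (phi G X) = 0"
proof -
  have acm: "almost_contact_metric n G"
    using G unfolding tk_max_rank_center_def by simp
  then have lie: "lie_bracket (br G)" and ip: "inner_product (met G)"
    unfolding almost_contact_metric_def by auto
  show m: "met G X (xi G) = eta G X" and "phi G (xi G) = 0" and "eta G (phi G X) = 0"
    using almost_contact_metric_xi[OF acm] by auto
  then show "met G (xi G) X = eta G X"
    using ip unfolding inner_product_def by metis
  have "1 *\<^sub>R xi G \<in> lie_center (br G)"
    unfolding contact_center[OF G] by blast
  then show b: "br G (xi G) X = 0"
    by (simp add: lie_center_def)
  then show "br G X (xi G) = 0"
    using lie_bracket_swap[OF lie, of X "xi G"] by simp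
qed

text \<open>Decomposing both arguments along \<xi> leaves only terms on \<open>ker \<eta>\<close>,
  because \<xi> is central, killed by \<open>phi\<close>, and a unit vector orthogonal to
  \<open>ker \<eta>\<close>.\<close>

lemma central_extensionI:
  assumes G: "G \<in> tk_max_rank_center n" and sp: "splitting (eta G) (xi G) p s"
    and br: "\<And>X Y. br H X Y = p (br G (s X) (s Y))"
    and symp: "\<And>X Y. symp H X Y = - eta G (br G (s X) (s Y))"
    and met: "\<And>X Y. met H X Y = met G (s X) (s Y)"
    and cpx: "\<And>X. cpx H X = p (phi G (s X))"
  shows "central_extension G H p s"
proof -
  interpret splitting "eta G" "xi G" p s by fact
  have bl: "bilinear (br G)" and blm: "bilinear (met G)" and lin_phi: "linear (phi G)"
    using G unfolding tk_max_rank_center_def almost_contact_metric_def lie_bracket_def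
      inner_product_def by auto
  note xi = contact_xi_simps[OF G]
  show ?thesis
  proof
    fix X Y
    have "br G X Y = br G (s (p X) + eta G X *\<^sub>R xi G) (s (p Y) + eta G Y *\<^sub>R xi G)"
      by (simp add: decomp)
    also have "\<dots> = br G (s (p X)) (s (p Y))"
      by (simp add: bilinear_ladd[OF bl] bilinear_radd[OF bl] bilinear_lmul[OF bl]
          bilinear_rmul[OF bl] xi)
    also have "\<dots> = s (p (br G (s (p X)) (s (p Y)))) + eta G (br G (s (p X)) (s (p Y))) *\<^sub>R xi G"
      by (simp add: decomp)
    finally show "br G X Y = s (br H (p X) (p Y)) - symp H (p X) (p Y) *\<^sub>R xi G"
      by (simp add: br symp)
    have "phi G X = phi G (s (p X) + eta G X *\<^sub>R xi G)"
      by (simp add: decomp)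
    also have "\<dots> = phi G (s (p X))"
      by (simp add: linear_add[OF lin_phi] linear_cmul[OF lin_phi] xi)
    finally have phiX: "phi G X = phi G (s (p X))" .
    show "phi G X = s (cpx H (p X))"
      by (rule split_eqI) (simp_all add: cpx phiX[symmetric] xi)
    have "met G X Y = met G (s (p X) + eta G X *\<^sub>R xi G) (s (p Y) + eta G Y *\<^sub>R xi G)"
      by (simp add: decomp)
    also have "\<dots> = met G (s (p X)) (s (p Y)) + eta G X * eta G Y"
      by (simp add: bilinear_ladd[OF blm] bilinear_radd[OF blm] bilinear_lmul[OF blm]
          bilinear_rmul[OF blm] xi)
    finally show "met G X Y = met H (p X) (p Y) + eta G X * eta G Y"
      by (simp add: met)
  qed
qed

text \<open>The kernel of the quotient map is the line of \<xi>, a complement of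
  \<open>ker \<eta>\<close>. Every element of \<open>H\<close> thus has exactly one lift in
  \<open>ker \<eta>\<close>.\<close>

lemma central_quotient_imp_extension:
  assumes G: "G \<in> tk_max_rank_center n" and q: "central_quotient G H"
  shows "\<exists>p s. central_extension G H p s"
proof -
  obtain p where p: "linear p" "surj p" "{X. p X = 0} = lie_center (br G)"
    and br: "\<And>X Y. p (br G X Y) = br H (p X) (p Y)"
    and phi: "\<And>X. p (phi G X) = cpx H (p X)"
    and met: "\<And>X Y. eta G X = 0 \<Longrightarrow> eta G Y = 0 \<Longrightarrow> met H (p X) (p Y) = met G X Y"
    and symp: "\<And>X Y. symp H (p X) (p Y) = d_eta G X Y"
    using q unfolding central_quotient_def by blast
  have lin_eta: "linear (eta G)" and e: "eta G (xi G) = 1"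
    using G unfolding tk_max_rank_center_def almost_contact_metric_def by auto
  note le = linear_add[OF lin_eta] linear_diff[OF lin_eta] linear_cmul[OF lin_eta]
  note lp = linear_add[OF p(1)] linear_diff[OF p(1)] linear_cmul[OF p(1)]
  have ker: "p X = 0 \<longleftrightarrow> X \<in> range (\<lambda>c. c *\<^sub>R xi G)" for X
    using p(3) unfolding contact_center[OF G] by blast
  have px: "p (xi G) = 0"
    unfolding ker by (metis rangeI scaleR_one)
  have uniq: "X = Y" if "p X = p Y" "eta G X = eta G Y" for X Y
  proof -
    have "p (X - Y) = 0"
      using that by (simp add: lp)
    then obtain c where c: "X - Y = c *\<^sub>R xi G"
      unfolding ker by blast
    have "c = eta G (c *\<^sub>R xi G)"
      by (simp add: le e)
    also have "\<dots> = 0"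
      using that(2) unfolding c[symmetric] by (simp add: le)
    finally have "c = 0" .
    then show ?thesis using c by simp
  qed
  have "\<exists>X. p X = Y \<and> eta G X = 0" for Y
  proof -
    obtain X where "p X = Y"
      using p(2) by (metis surjD)
    then have "p (X - eta G X *\<^sub>R xi G) = Y \<and> eta G (X - eta G X *\<^sub>R xi G) = 0"
      by (simp add: lp le px e)
    then show ?thesis by blast
  qed
  then obtain s where s: "\<And>Y. p (s Y) = Y" "\<And>Y. eta G (s Y) = 0"
    by metis
  \<comment> \<open>The lifts were chosen pointwise; their uniqueness makes the choice
    linear.\<close>
  have "linear s"
    unfolding linear_iff by (intro conjI allI; rule uniq) (simp_all add: lp le s)
  then have sp: "splitting (eta G) (xi G) p s"
    by unfold_locales (use lin_eta p(1) s px e in \<open>auto intro!: uniq simp: lp le\<close>)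
  have "central_extension G H p s"
  proof (rule central_extensionI[OF G sp])
    fix X Y
    show "br H X Y = p (br G (s X) (s Y))"
      using br[of "s X" "s Y"] by (simp add: s)
    show "symp H X Y = - eta G (br G (s X) (s Y))"
      using symp[of "s X" "s Y"] by (simp add: s d_eta_def d1_def)
    show "met H X Y = met G (s X) (s Y)"
      using met[of "s X" "s Y"] by (simp add: s)
    show "cpx H X = p (phi G (s X))"
      using phi[of "s X"] by (simp add: s)
  qed
  then show ?thesis by blast
qed


section \<open>The correspondence\<close>

text \<open>\<open>Q\<close> is a relation, since a quotient is determined only up to isomorphism.
  That \<open>R\<close> is an equivalence is not assumed but pulled back from \<open>S\<close> along
  \<open>Q\<close>.\<close>

lemma bij_betw_quotients:
  assumes S: "equiv B S" and RA: "R \<subseteq> A \<times> A"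
    and tot: "\<And>a. a \<in> A \<Longrightarrow> \<exists>b. Q a b"
    and into: "\<And>a b. a \<in> A \<Longrightarrow> Q a b \<Longrightarrow> b \<in> B"
    and onto: "\<And>b. b \<in> B \<Longrightarrow> \<exists>a\<in>A. Q a b"
    and rel: "\<And>a a' b b'. a \<in> A \<Longrightarrow> a' \<in> A \<Longrightarrow> Q a b \<Longrightarrow> Q a' b' \<Longrightarrow> (a, a') \<in> R \<longleftrightarrow> (b, b') \<in> S"
    and sat: "\<And>a b b'. a \<in> A \<Longrightarrow> Q a b \<Longrightarrow> (b, b') \<in> S \<Longrightarrow> Q a b'"
  shows "bij_betw (\<lambda>C. {b. \<exists>a\<in>C. Q a b}) (A // R) (B // S)"
proof -
  have refl: "(a, a) \<in> R" if "a \<in> A" for a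
    using tot[OF that] into[OF that] rel[OF that that] equiv_class_self[OF S] by blast
  have sym: "(a', a) \<in> R" if "(a, a') \<in> R" for a a'
  proof -
    have a: "a \<in> A" "a' \<in> A"
      using RA that by auto
    obtain b b' where q: "Q a b" "Q a' b'"
      using tot[OF a(1)] tot[OF a(2)] by blast
    then show ?thesis
      using rel[OF a q] rel[OF a(2,1) q(2,1)] that S by (meson equivE symD)
  qed
  have trans: "(a, c) \<in> R" if "(a, b) \<in> R" "(b, c) \<in> R" for a b c
  proof -
    have abc: "a \<in> A" "b \<in> A" "c \<in> A"
      using RA that by auto
    obtain a' b' c' where q: "Q a a'" "Q b b'" "Q c c'"
      using tot[OF abc(1)] tot[OF abc(2)] tot[OF abc(3)] by blast
    have "(a', b') \<in> S" "(b', c') \<in> S"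
      using rel[OF abc(1,2) q(1,2)] rel[OF abc(2,3) q(2,3)] that by simp_all
    then have "(a', c') \<in> S"
      using S by (meson equivE transD)
    then show ?thesis
      using rel[OF abc(1,3) q(1,3)] by simp
  qed
  have R: "equiv A R"
  proof (rule equivI)
    show "R \<subseteq> A \<times> A" by (rule RA)
    show "refl_on A R" by (rule refl_onI) (rule refl)
    show "sym R" by (rule symI) (rule sym)
    show "trans R" by (rule transI) (rule trans)
  qed
  \<comment> \<open>The class of \<open>a\<close> is sent onto the whole class of \<open>b\<close>:
    \<open>rel\<close> gives one inclusion, and \<open>sat\<close>, with \<open>a\<close> as its own
    representative, the other.\<close>
  have cls: "{b'. \<exists>a'\<in>R `` {a}. Q a' b'} = S `` {b}" if a: "a \<in> A" and q: "Q a b" for a b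
  proof (intro set_eqI iffI)
    fix b' assume "b' \<in> {b'. \<exists>a'\<in>R `` {a}. Q a' b'}"
    then obtain a' where "(a, a') \<in> R" "Q a' b'" by blast
    moreover from this have "a' \<in> A"
      using RA by blast
    ultimately show "b' \<in> S `` {b}"
      using rel[OF a _ q] by blast
  next
    fix b' assume "b' \<in> S `` {b}"
    then show "b' \<in> {b'. \<exists>a'\<in>R `` {a}. Q a' b'}"
      using sat[OF a q] refl[OF a] by blast
  qed
  show ?thesis
  proof (rule bij_betw_imageI[OF inj_onI equalityI[OF subsetI subsetI]])
    fix C D
    assume "C \<in> A // R" "D \<in> A // R" and eq: "{b. \<exists>a\<in>C. Q a b} = {b. \<exists>a\<in>D. Q a b}"
    then obtain a a' where a: "a \<in> A" "C = R `` {a}" "a' \<in> A" "D = R `` {a'}"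
      by (auto elim!: quotientE)
    obtain b b' where b: "Q a b" "Q a' b'"
      using tot[OF a(1)] tot[OF a(3)] by blast
    have "S `` {b} = S `` {b'}"
      using eq cls[OF a(1) b(1)] cls[OF a(3) b(2)] a by simp
    then have "(b, b') \<in> S"
      using eq_equiv_class[OF _ S into[OF a(3) b(2)]] by simp
    then show "C = D"
      using rel[OF a(1,3) b] equiv_class_eq[OF R] a by simp
  next
    fix E assume "E \<in> (\<lambda>C. {b. \<exists>a\<in>C. Q a b}) ` (A // R)"
    then obtain a where a: "a \<in> A" "E = {b. \<exists>a'\<in>R `` {a}. Q a' b}"
      by (auto elim!: quotientE)
    obtain b where b: "Q a b"
      using tot[OF a(1)] by blast
    show "E \<in> B // S"
      unfolding a(2) cls[OF a(1) b] by (rule quotientI[OF into[OF a(1) b]])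
  next
    fix E assume "E \<in> B // S"
    then obtain b where b: "b \<in> B" "E = S `` {b}"
      by (auto elim!: quotientE)
    then obtain a where "a \<in> A" "Q a b"
      using onto[OF b(1)] by blast
    then show "E \<in> (\<lambda>C. {b. \<exists>a\<in>C. Q a b}) ` (A // R)"
      using cls b(2) by (intro image_eqI[of _ _ "R `` {a}"]) (auto intro: quotientI)
  qed
qed

section \<open>Isomorphism of Kaehler Lie algebras as an equivalence relation\<close>

lemma kaehler_isomorphic_refl: "kaehler_isomorphic H H"
  unfolding kaehler_isomorphic_def by (intro exI[of _ "\<lambda>X. X"]) (auto simp: linear_ident bij_id[unfolded id_def])

lemma kaehler_isomorphic_sym:
  assumes "kaehler_isomorphic H H'"
  shows "kaehler_isomorphic H' H"
proof -
  obtain f where f: "linear f" "bij f" "\<And>X Y. f (br H X Y) = br H' (f X) (f Y)"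
    "\<And>X. f (cpx H X) = cpx H' (f X)" "\<And>X Y. met H' (f X) (f Y) = met H X Y"
    "\<And>X Y. symp H' (f X) (f Y) = symp H X Y"
    using assms unfolding kaehler_isomorphic_def by blast
  have fi: "f (inv f X) = X" "inv f (f X) = X" for X
    using f(2) by (simp_all add: bij_is_surj surj_f_inv_f bij_is_inj)
  have inj: "f X = f Y \<Longrightarrow> X = Y" for X Y
    by (metis fi(2))
  have "linear (inv f)"
    unfolding linear_iff
    by (intro conjI allI; rule inj) (simp_all add: fi linear_add[OF f(1)] linear_cmul[OF f(1)])
  moreover have "bij (inv f)"
    using f(2) by (rule bij_imp_bij_inv)
  moreover have "inv f (br H' X Y) = br H (inv f X) (inv f Y)" for X Y
    by (rule inj) (simp add: fi f(3))
  moreover have "inv f (cpx H' X) = cpx H (inv f X)" for X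
    by (rule inj) (simp add: fi f(4))
  moreover have "met H (inv f X) (inv f Y) = met H' X Y" for X Y
    using f(5)[of "inv f X" "inv f Y"] by (simp add: fi)
  moreover have "symp H (inv f X) (inv f Y) = symp H' X Y" for X Y
    using f(6)[of "inv f X" "inv f Y"] by (simp add: fi)
  ultimately show ?thesis
    unfolding kaehler_isomorphic_def by blast
qed

lemma kaehler_isomorphic_trans:
  assumes "kaehler_isomorphic H H'" "kaehler_isomorphic H' H''"
  shows "kaehler_isomorphic H H''"
proof -
  obtain f where f: "linear f" "bij f" "\<And>X Y. f (br H X Y) = br H' (f X) (f Y)"
    "\<And>X. f (cpx H X) = cpx H' (f X)" "\<And>X Y. met H' (f X) (f Y) = met H X Y"
    "\<And>X Y. symp H' (f X) (f Y) = symp H X Y"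
    using assms(1) unfolding kaehler_isomorphic_def by blast
  obtain g where g: "linear g" "bij g" "\<And>X Y. g (br H' X Y) = br H'' (g X) (g Y)"
    "\<And>X. g (cpx H' X) = cpx H'' (g X)" "\<And>X Y. met H'' (g X) (g Y) = met H' X Y"
    "\<And>X Y. symp H'' (g X) (g Y) = symp H' X Y"
    using assms(2) unfolding kaehler_isomorphic_def by blast
  show ?thesis
    unfolding kaehler_isomorphic_def
    by (intro exI[of _ "g \<circ> f"] conjI)
      (auto simp: f g intro: linear_compose bij_comp)
qed

lemma equiv_kaehler_iso_rel: "equiv (kaehler_symplectic n) (kaehler_iso_rel n)"
proof (rule equivI)
  show "kaehler_iso_rel n \<subseteq> kaehler_symplectic n \<times> kaehler_symplectic n"
    by (auto simp: kaehler_iso_rel_def)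
  show "refl_on (kaehler_symplectic n) (kaehler_iso_rel n)"
    by (auto simp: kaehler_iso_rel_def refl_on_def kaehler_isomorphic_refl)
  show "sym (kaehler_iso_rel n)"
    by (auto simp: kaehler_iso_rel_def sym_def kaehler_isomorphic_sym)
  show "trans (kaehler_iso_rel n)"
    by (auto simp: kaehler_iso_rel_def trans_def intro: kaehler_isomorphic_trans)
qed

text \<open>Composing the quotient map with an isomorphism gives a quotient map again, so
  \<open>quotient_class\<close> yields full isomorphism classes.\<close>

lemma central_quotient_iso:
  assumes "central_quotient G H" "kaehler_isomorphic H H'"
  shows "central_quotient G H'"
proof -
  obtain p where p: "linear p" "surj p" "{X. p X = 0} = lie_center (br G)"
    "\<And>X Y. p (br G X Y) = br H (p X) (p Y)" "\<And>X. p (phi G X) = cpx H (p X)"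
    "\<And>X Y. eta G X = 0 \<Longrightarrow> eta G Y = 0 \<Longrightarrow> met H (p X) (p Y) = met G X Y"
    "\<And>X Y. symp H (p X) (p Y) = d_eta G X Y"
    using assms(1) unfolding central_quotient_def by blast
  obtain f where f: "linear f" "bij f" "\<And>X Y. f (br H X Y) = br H' (f X) (f Y)"
    "\<And>X. f (cpx H X) = cpx H' (f X)" "\<And>X Y. met H' (f X) (f Y) = met H X Y"
    "\<And>X Y. symp H' (f X) (f Y) = symp H X Y"
    using assms(2) unfolding kaehler_isomorphic_def by blast
  have "f (p X) = 0 \<longleftrightarrow> p X = 0" for X
    using linear_0[OF f(1)] bij_is_inj[OF f(2)] by (metis injD)
  then have "{X. (f \<circ> p) X = 0} = lie_center (br G)"
    using p(3) by simp
  moreover have "surj (f \<circ> p)"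
    using p(2) bij_is_surj[OF f(2)] by (rule comp_surj)
  moreover have "linear (f \<circ> p)"
    using p(1) f(1) by (rule linear_compose)
  ultimately show ?thesis
    unfolding central_quotient_def
    by (intro exI[of _ "f \<circ> p"]) (simp add: p(4-7) f(5,6) flip: f(3,4))
qed

theorem theorem3p7:
  fixes n :: nat
  assumes "has_dimension TYPE('a::real_vector) (2 * n + 1)"
    and "has_dimension TYPE('b::real_vector) (2 * n)"
  shows "bij_betw (quotient_class :: 'a acm_lie set \<Rightarrow> 'b kaehler_lie set)
           (tk_max_rank_center n // acm_iso_rel n)
           (kaehler_symplectic n // kaehler_iso_rel n)"
proof -
  let ?A = "tk_max_rank_center n :: 'a acm_lie set"
  let ?B = "kaehler_symplectic n :: 'b kaehler_lie set"
  have quotI: "central_quotient G H"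
    if "central_extension G H p s" "H \<in> ?B" for G :: "'a acm_lie" and H p s
    using that central_extension.central_quotientI[OF that(1)]
    unfolding kaehler_symplectic_def Kaehler_lie_algebra_def lie_bracket_def symplectic_form_def
      closed_two_form_def two_form_def by blast
  have "bij_betw (\<lambda>C. {H. \<exists>G\<in>C. central_quotient G H})
      (?A // acm_iso_rel n) (?B // kaehler_iso_rel n)"
  proof (rule bij_betw_quotients)
    show "equiv ?B (kaehler_iso_rel n)"
      by (rule equiv_kaehler_iso_rel)
    show "acm_iso_rel n \<subseteq> ?A \<times> ?A"
      by (auto simp: acm_iso_rel_def)
  next
    fix G assume G: "G \<in> ?A"
    then have "linear (eta G)" "eta G (xi G) = 1"
      unfolding tk_max_rank_center_def almost_contact_metric_def by auto
    then obtain p :: "'a \<Rightarrow> 'b" and s where sp: "splitting (eta G) (xi G) p s"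
      using splitting_exists[OF assms] by blast
    \<comment> \<open>The structure on \<open>ker \<eta>\<close>, projected along \<xi> and carried
      to \<open>'b\<close>.\<close>
    define H where "H = \<lparr>br = \<lambda>X Y. p (br G (s X) (s Y)), met = \<lambda>X Y. met G (s X) (s Y),
      cpx = \<lambda>X. p (phi G (s X)), symp = \<lambda>X Y. - eta G (br G (s X) (s Y))\<rparr>"
    have ext: "central_extension G H p s"
      by (rule central_extensionI[OF G sp]) (simp_all add: H_def)
    then show "\<exists>H :: 'b kaehler_lie. central_quotient G H"
      using quotI central_extension.contact_imp_kaehler[OF ext assms(2) G] by blast
  next
    fix G and H :: "'b kaehler_lie"
    assume "G \<in> ?A" "central_quotient G H"
    then show "H \<in> ?B"
      using central_quotient_imp_extension central_extension.contact_imp_kaehler[OF _ assms(2)] by blast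
  next
    fix H :: "'b kaehler_lie" assume H: "H \<in> ?B"
    \<comment> \<open>Only the dimension of \<open>'a\<close> is known, so an arbitrary covector and
      a vector on which it is \<open>1\<close> serve as \<eta> and \<xi>.\<close>
    obtain e :: "'a \<Rightarrow> real" and x where "linear e" "e x = 1"
      using has_dimension_covector[OF assms(1)] .
    then obtain p :: "'a \<Rightarrow> 'b" and s where sp: "splitting e x p s"
      using splitting_exists[OF assms] by blast
    define G where "G = \<lparr>br = \<lambda>X Y. s (br H (p X) (p Y)) - symp H (p X) (p Y) *\<^sub>R x,
      met = \<lambda>X Y. met H (p X) (p Y) + e X * e Y, phi = \<lambda>X. s (cpx H (p X)), xi = x, eta = e\<rparr>"
    have ext: "central_extension G H p s"
      using sp by (simp add: central_extension_def central_extension_axioms_def G_def)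
    show "\<exists>G\<in>?A. central_quotient G H"
      using quotI[OF ext H] central_extension.kaehler_imp_contact[OF ext assms(1) H] by blast
  next
    fix G G' and H H' :: "'b kaehler_lie"
    assume GG: "G \<in> ?A" "G' \<in> ?A" and q: "central_quotient G H" "central_quotient G' H'"
    obtain p s where e: "central_extension G H p s"
      using central_quotient_imp_extension GG q by blast
    obtain p' s' where e': "central_extension G' H' p' s'"
      using central_quotient_imp_extension GG q by blast
    have "H \<in> ?B" "H' \<in> ?B"
      using central_extension.contact_imp_kaehler[OF _ assms(2)] e e' GG by blast+
    then show "(G, G') \<in> acm_iso_rel n \<longleftrightarrow> (H, H') \<in> kaehler_iso_rel n"
      using GG central_extension_iso_iff[OF e e'] by (simp add: acm_iso_rel_def kaehler_iso_rel_def)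
  next
    fix G and H H' :: "'b kaehler_lie"
    assume "central_quotient G H" "(H, H') \<in> kaehler_iso_rel n"
    then show "central_quotient G H'"
      using central_quotient_iso by (auto simp: kaehler_iso_rel_def)
  qed
  then show ?thesis
    unfolding quotient_class_def .
qed

end
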